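(* Consider the model and dynamics described in the context, with constants $a>b>0$, $\alpha\in\mathbb{R}$, $\eta\in(0,1]$, $\lambda_n\to\infty$, and community-size limits $v^1,v^2\in(0,\infty)$. Assume that $v^1\ge v^2$ and, if $v^1>v^2$, that $$\frac{bv^1-av^2}{v^1-v^2}<\alpha<\frac{av^1-bv^2}{v^1-v^2}$$ (if $v^1=v^2$, $\alpha$ may be any real number). Let $\beta_n\in(0,\infty]$ satisfy $\lim_{n\to\infty}\frac{\beta_n\lambda_n}{\log\lambda_n}=\infty$. Let $t_n=c\log\lambda_n$ with $0<c<1/4$. Then $$\max\big\{|\boldsymbol{z}^1_n(t_n)-1|,\ |\boldsymbol{z}^2_n(t_n)+1|\big\}\Rightarrow0\quad\text{as }n\to\infty,$$ and this convergence also holds in expectation, i.e. $E\big[\max\{|\boldsymbol{z}^1_n(t_n)-1|,|\boldsymbol{z}^2_n(t_n)+1|\}\big]\to0$.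
   Context: Model: for each $n$, the node set $\mathcal{V}_n=\mathcal{V}_n^1\cup\mathcal{V}_n^2$ is a disjoint union of two communities of sizes $V_n^k=|\mathcal{V}_n^k|$ with $V_n^k/n\to v^k\in(0,\infty)$, $k=1,2$. The graph $\mathcal{G}_n$ on $\mathcal{V}_n$ is a stochastic block model: each unordered pair of distinct nodes is an edge independently, with probability $a_n=a\lambda_n/n$ if both nodes are in the same community and $b_n=b\lambda_n/n$ otherwise, where $a>b>0$ are constants and $\lambda_n\to\infty$. Write $u\sim v$ if $\{u,v\}$ is an edge. A configuration is a map $\sigma:\mathcal{V}_n\to\{-1,1\}$. Let $\alpha_n=\alpha\lambda_n/n$ and define $\Delta_n(\sigma,u)=2\sigma(u)\big[\sum_{v\sim u}\sigma(v)-\alpha_n\sum_{v\neq u}\sigma(v)\big]$. Let $r(x)=1/(1+e^x)$; when $\beta_n=\infty$ one uses the convention $r(\beta_n x)=\mathbf{1}\{x<0\}+\tfrac12\mathbf{1}\{x=0\}$. Dynamics (Glauber dynamics): given $\mathcal{G}_n$, $\boldsymbol{\sigma}_n(t)$ is the continuous-time Markov chain on configurations in which the spin of each node $u$ flips independently at rate $r(\beta_n\Delta_n(\boldsymbol{\sigma}_n(t),u))$. Initialization: independently for each node $u$, with probability $\eta$ the spin is set to $\boldsymbol{\sigma}_n(0,u)=\mathbf{1}\{u\in\mathcal{V}_n^1\}-\mathbf{1}\{u\in\mathcal{V}_n^2\}$, and otherwise $\boldsymbol{\sigma}_n(0,u)$ is uniform on $\{-1,1\}$. Magnetizations: $\boldsymbol{z}^k_n(t)=\frac{1}{V_n^k}\sum_{u\in\mathcal{V}_n^k}\boldsymbol{\sigma}_n(t,u)$.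 $\Rightarrow$ denotes weak convergence (here to a constant, i.e. convergence in probability). *)

theory Defs
  imports Complex_Main "HOL-Library.Extended_Real" "HOL-Library.FuncSet"
begin

text \<open>Node set: {0..<V1+V2}; community 1 = {0..<V1}, community 2 = {V1..<V1+V2}.
  Undirected simple graphs are sets of pairs (u,v) with u < v < N.\<close>

definition pairs :: "nat \<Rightarrow> (nat \<times> nat) set" where
  "pairs N = {(u, v). u < v \<and> v < N}"

definition adj :: "(nat \<times> nat) set \<Rightarrow> nat \<Rightarrow> nat \<Rightarrow> bool" where
  "adj E u v = (u \<noteq> v \<and> (min u v, max u v) \<in> E)"

definition edge_prob :: "nat \<Rightarrow> real \<Rightarrow> real \<Rightarrow> nat \<times> nat \<Rightarrow> real" where
  "edge_prob V1 pin pout p = (if (fst p < V1) = (snd p < V1) then pin else pout)"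

definition graph_prob :: "nat \<Rightarrow> nat \<Rightarrow> real \<Rightarrow> real \<Rightarrow> (nat \<times> nat) set \<Rightarrow> real" where
  "graph_prob N V1 pin pout E =
     (\<Prod>p\<in>pairs N. if p \<in> E then edge_prob V1 pin pout p else 1 - edge_prob V1 pin pout p)"

definition configs :: "nat \<Rightarrow> (nat \<Rightarrow> real) set" where
  "configs N = PiE {0..<N} (\<lambda>_. {-1, 1})"

definition flip_rate :: "ereal \<Rightarrow> real \<Rightarrow> real" where
  "flip_rate \<beta> x = (if \<beta> = \<infinity> then (if x < 0 then 1 else if x = 0 then 1/2 else 0)
                     else 1 / (1 + exp (real_of_ereal \<beta> * x)))"

definition Delta :: "nat \<Rightarrow> (nat \<times> nat) set \<Rightarrow> real \<Rightarrow> (nat \<Rightarrow> real) \<Rightarrow> nat \<Rightarrow> real" where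
  "Delta N E alph \<sigma> u =
     2 * \<sigma> u * ((\<Sum>v\<in>{v. v < N \<and> adj E u v}. \<sigma> v) - alph * (\<Sum>v\<in>{0..<N} - {u}. \<sigma> v))"

definition flip :: "(nat \<Rightarrow> real) \<Rightarrow> nat \<Rightarrow> (nat \<Rightarrow> real)" where
  "flip \<sigma> u = \<sigma>(u := - \<sigma> u)"

definition generator :: "nat \<Rightarrow> (nat \<times> nat) set \<Rightarrow> real \<Rightarrow> ereal \<Rightarrow> (nat \<Rightarrow> real) \<Rightarrow> (nat \<Rightarrow> real) \<Rightarrow> real" where
  "generator N E alph \<beta> \<sigma> \<sigma>' =
     (if \<sigma>' = \<sigma> then - (\<Sum>u<N. flip_rate \<beta> (Delta N E alph \<sigma> u))
      else (\<Sum>u\<in>{u. u < N \<and> \<sigma>' = flip \<sigma> u}. flip_rate \<beta> (Delta N E alph \<sigma> u)))"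

fun mat_pow :: "'s set \<Rightarrow> ('s \<Rightarrow> 's \<Rightarrow> real) \<Rightarrow> nat \<Rightarrow> 's \<Rightarrow> 's \<Rightarrow> real" where
  "mat_pow S Q 0 x y = (if x = y then 1 else 0)"
| "mat_pow S Q (Suc k) x y = (\<Sum>z\<in>S. Q x z * mat_pow S Q k z y)"

definition ctmc_trans :: "'s set \<Rightarrow> ('s \<Rightarrow> 's \<Rightarrow> real) \<Rightarrow> real \<Rightarrow> 's \<Rightarrow> 's \<Rightarrow> real" where
  "ctmc_trans S Q t x y = (\<Sum>k. t ^ k / fact k * mat_pow S Q k x y)"

text \<open>Initial law: independently, with prob. eta the true label, otherwise uniform.\<close>
definition init_prob :: "nat \<Rightarrow> nat \<Rightarrow> real \<Rightarrow> (nat \<Rightarrow> real) \<Rightarrow> real" where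
  "init_prob N V1 \<eta> \<sigma> =
     (\<Prod>u<N. \<eta> * (if \<sigma> u = (if u < V1 then 1 else -1) then 1 else 0) + (1 - \<eta>) / 2)"

definition magnet :: "nat set \<Rightarrow> (nat \<Rightarrow> real) \<Rightarrow> real" where
  "magnet A \<sigma> = (\<Sum>u\<in>A. \<sigma> u) / real (card A)"

definition expect_at :: "nat \<Rightarrow> nat \<Rightarrow> real \<Rightarrow> real \<Rightarrow> real \<Rightarrow> ereal \<Rightarrow> real \<Rightarrow> real
                         \<Rightarrow> ((nat \<Rightarrow> real) \<Rightarrow> real) \<Rightarrow> real" where
  "expect_at V1 V2 pin pout alph \<beta> \<eta> t f =
     (let N = V1 + V2 in
      \<Sum>E\<in>Pow (pairs N). graph_prob N V1 pin pout E *
        (\<Sum>\<sigma>0\<in>configs N. init_prob N V1 \<eta> \<sigma>0 *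
          (\<Sum>\<sigma>\<in>configs N. ctmc_trans (configs N) (generator N E alph \<beta>) t \<sigma>0 \<sigma> * f \<sigma>)))"

definition err :: "nat \<Rightarrow> nat \<Rightarrow> (nat \<Rightarrow> real) \<Rightarrow> real" where
  "err V1 V2 \<sigma> = max \<bar>magnet {0..<V1} \<sigma> - 1\<bar> \<bar>magnet {V1..<V1 + V2} \<sigma> + 1\<bar>"

end

theory Submission
  imports Defs "HOL-Library.Disjoint_Sets" "HOL-Real_Asymp.Real_Asymp"
begin

text \<open>
  Multiply every spin by the label of its community; the two magnetisations should then both tend
  to 1. Let \<open>m t = 1 - (1 - \<eta>) exp (- t)\<close>, the solution of the mean-field equation \<open>m' = 1 - m\<close>, and
  let \<open>D\<close> be the squared distance of the pair of magnetisations from \<open>(m t, m t)\<close>. While \<open>D\<close> is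
  small, the assumptions on \<open>\<alpha>\<close> give the mean field at every node the sign of its label with a
  margin of order \<open>\<lambda>\<close>. A Chernoff bound and a union bound over pairs of sign vectors show that, with
  high probability, the fluctuation of the adjacency matrix applied to \<^emph>\<open>any\<close> configuration has
  \<open>\<ell>\<^sub>1\<close> norm at most \<open>C n \<surd>\<lambda>\<close>, so all but \<open>O(n / \<surd>\<lambda>)\<close> nodes are pushed towards their label at nearly
  full rate and \<open>D\<close> has drift \<open>O(1 / \<lambda>)\<close>. The function \<open>1 - exp (- k D)\<close> with \<open>k = \<surd>\<lambda>\<close> is concave in
  \<open>D\<close> and almost flat where \<open>D\<close> is not small, so its drift is small everywhere, even where that of
  \<open>D\<close> is not. Hence its expectation stays small up to times of order \<open>ln \<lambda>\<close>, without any stopping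
  time argument, and \<open>m t\<close> is close to 1 by then.
\<close>

section \<open>Finite probability distributions\<close>

definition mean :: "'s set \<Rightarrow> ('s \<Rightarrow> real) \<Rightarrow> ('s \<Rightarrow> real) \<Rightarrow> real" where
  "mean S p f = (\<Sum>x\<in>S. p x * f x)"

lemma mean_cong: "(\<And>x. x \<in> S \<Longrightarrow> f x = g x) \<Longrightarrow> mean S p f = mean S p g"
  by (simp add: mean_def)

lemma mean_add: "mean S p (\<lambda>x. f x + g x) = mean S p f + mean S p g"
  by (simp add: mean_def distrib_left sum.distrib)

lemma mean_cmult: "mean S p (\<lambda>x. k * f x) = k * mean S p f"
  by (simp add: mean_def sum_distrib_left mult_ac)

lemma mean_sum: "mean S p (\<lambda>x. \<Sum>i\<in>I. f i x) = (\<Sum>i\<in>I. mean S p (f i))"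
  unfolding mean_def sum_distrib_left by (rule sum.swap)

lemma mean_mean: "mean S p (\<lambda>x. mean T (q x) f) = mean T (\<lambda>y. mean S p (\<lambda>x. q x y)) f"
  unfolding mean_def sum_distrib_left sum_distrib_right mult.assoc by (rule sum.swap)

locale prob_weights =
  fixes S :: "'s set" and p :: "'s \<Rightarrow> real"
  assumes nonneg: "x \<in> S \<Longrightarrow> 0 \<le> p x" and sum_eq_1: "sum p S = 1"
begin

lemma mean_const: "mean S p (\<lambda>_. k) = k"
  using sum_eq_1 by (simp add: mean_def flip: sum_distrib_right)

lemma mean_mono: "(\<And>x. x \<in> S \<Longrightarrow> f x \<le> g x) \<Longrightarrow> mean S p f \<le> mean S p g"
  unfolding mean_def by (intro sum_mono mult_left_mono nonneg)

lemma mean_nonneg: "(\<And>x. x \<in> S \<Longrightarrow> 0 \<le> f x) \<Longrightarrow> 0 \<le> mean S p f"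
  using mean_mono[of "\<lambda>_. 0" f] by (simp add: mean_const)

lemma mean_le_const: "(\<And>x. x \<in> S \<Longrightarrow> f x \<le> k) \<Longrightarrow> mean S p f \<le> k"
  using mean_mono[of f "\<lambda>_. k"] by (simp add: mean_const)

lemma mean_le_level_plus_tail:
  assumes "\<And>x. x \<in> S \<Longrightarrow> f x \<le> K" "0 \<le> \<epsilon>"
  shows "mean S p f \<le> \<epsilon> + K * mean S p (\<lambda>x. if \<epsilon> < f x then 1 else 0)"
proof -
  have "mean S p f \<le> mean S p (\<lambda>x. \<epsilon> + K * (if \<epsilon> < f x then 1 else 0))"
    using assms by (intro mean_mono) (auto intro: add_increasing)
  then show ?thesis by (simp only: mean_add mean_cmult mean_const)
qed

lemma prob_weights_mixture:
  assumes "\<And>x. x \<in> S \<Longrightarrow> prob_weights T (q x)"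
  shows "prob_weights T (\<lambda>y. mean S p (\<lambda>x. q x y))"
proof
  show "0 \<le> mean S p (\<lambda>x. q x y)" if "y \<in> T" for y
    using assms that by (intro mean_nonneg prob_weights.nonneg)
  have "(\<Sum>y\<in>T. mean S p (\<lambda>x. q x y)) = mean S p (\<lambda>x. sum (q x) T)"
    by (rule mean_sum[symmetric])
  also have "\<dots> = mean S p (\<lambda>_. 1)"
    using assms by (intro mean_cong prob_weights.sum_eq_1)
  finally show "(\<Sum>y\<in>T. mean S p (\<lambda>x. q x y)) = 1" by (simp add: mean_const)
qed

end

lemma tendsto_mean_of_tendsto_in_prob:
  assumes weights: "\<forall>\<^sub>F n in F. prob_weights (S n) (p n)"
    and f_nonneg: "\<And>n x. x \<in> S n \<Longrightarrow> 0 \<le> f n x" and f_le: "\<And>n x. x \<in> S n \<Longrightarrow> f n x \<le> K" and "0 < K"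
    and in_prob: "\<And>\<epsilon>. 0 < \<epsilon> \<Longrightarrow> ((\<lambda>n. mean (S n) (p n) (\<lambda>x. if \<epsilon> < f n x then 1 else 0)) \<longlongrightarrow> 0) F"
  shows "((\<lambda>n. mean (S n) (p n) (f n)) \<longlongrightarrow> 0) F"
proof (rule order_tendstoI)
  fix y :: real assume "y < 0"
  show "\<forall>\<^sub>F n in F. y < mean (S n) (p n) (f n)"
    using weights
    by eventually_elim (use \<open>y < 0\<close> in \<open>meson prob_weights.mean_nonneg f_nonneg less_le_trans\<close>)
next
  fix y :: real assume y: "0 < y"
  then have "\<forall>\<^sub>F n in F. mean (S n) (p n) (\<lambda>x. if y / 2 < f n x then 1 else 0) < y / (2 * K)"
    using \<open>0 < K\<close> by (intro order_tendstoD(2)[OF in_prob]) simp_all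
  then show "\<forall>\<^sub>F n in F. mean (S n) (p n) (f n) < y"
    using weights
  proof eventually_elim
    case (elim n)
    have "mean (S n) (p n) (f n)
        \<le> y / 2 + K * mean (S n) (p n) (\<lambda>x. if y / 2 < f n x then 1 else 0)"
      using y f_le elim(2) by (intro prob_weights.mean_le_level_plus_tail) simp_all
    then show ?case using elim(1) \<open>0 < K\<close> by (simp add: field_simps)
  qed
qed

section \<open>Finite continuous-time Markov chains\<close>

lemma mat_pow_Suc_right:
  assumes "finite S" "x \<in> S" "y \<in> S"
  shows "mat_pow S Q (Suc k) x y = (\<Sum>z\<in>S. mat_pow S Q k x z * Q z y)"
  using assms(2)
proof (induction k arbitrary: x)
  case 0
  then show ?case
    using assms by (simp add: if_distrib[of "\<lambda>u. u * _"] if_distrib[of "\<lambda>u. _ * u"] cong: if_cong)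
next
  case (Suc k)
  have "mat_pow S Q (Suc (Suc k)) x y = (\<Sum>z\<in>S. Q x z * (\<Sum>w\<in>S. mat_pow S Q k z w * Q w y))"
    using Suc.IH by simp
  also have "\<dots> = (\<Sum>w\<in>S. \<Sum>z\<in>S. Q x z * (mat_pow S Q k z w * Q w y))"
    unfolding sum_distrib_left by (rule sum.swap)
  also have "\<dots> = (\<Sum>w\<in>S. mat_pow S Q (Suc k) x w * Q w y)"
    by (simp add: sum_distrib_right mult.assoc)
  finally show ?case .
qed

lemma abs_mat_pow_le:
  assumes "finite S" "x \<in> S"
  shows "\<bar>mat_pow S Q k x y\<bar> \<le> (\<Sum>w\<in>S. \<Sum>z\<in>S. \<bar>Q w z\<bar>) ^ k"
  using assms(2)
proof (induction k arbitrary: x)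
  case 0
  then show ?case by simp
next
  case (Suc k)
  let ?M = "\<Sum>w\<in>S. \<Sum>z\<in>S. \<bar>Q w z\<bar>"
  have M: "?M \<ge> 0" by (intro sum_nonneg) auto
  have "\<bar>mat_pow S Q (Suc k) x y\<bar> \<le> (\<Sum>z\<in>S. \<bar>Q x z\<bar> * \<bar>mat_pow S Q k z y\<bar>)"
    unfolding mat_pow.simps abs_mult[symmetric] by (rule sum_abs)
  also have "\<dots> \<le> (\<Sum>z\<in>S. \<bar>Q x z\<bar> * ?M ^ k)"
    by (intro sum_mono mult_left_mono Suc.IH) auto
  also have "\<dots> = (\<Sum>z\<in>S. \<bar>Q x z\<bar>) * ?M ^ k" by (simp add: sum_distrib_right)
  also have "\<dots> \<le> ?M * ?M ^ k"
    using assms(1) Suc.prems M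
    by (intro mult_right_mono member_le_sum[where f = "\<lambda>w. \<Sum>z\<in>S. \<bar>Q w z\<bar>"]) (auto intro: sum_nonneg)
  finally show ?case by simp
qed

lemma summable_mat_exp:
  assumes "finite S" "x \<in> S"
  shows "summable (\<lambda>k. mat_pow S Q k x y / fact k * t ^ k)"
proof (rule summable_comparison_test')
  let ?M = "\<Sum>w\<in>S. \<Sum>z\<in>S. \<bar>Q w z\<bar>"
  show "summable (\<lambda>k. inverse (fact k) * (?M * \<bar>t\<bar>) ^ k)" by (rule summable_exp)
  show "norm (mat_pow S Q k x y / fact k * t ^ k) \<le> inverse (fact k) * (?M * \<bar>t\<bar>) ^ k" for k
  proof -
    have "norm (mat_pow S Q k x y / fact k * t ^ k)
        = inverse (fact k) * (\<bar>mat_pow S Q k x y\<bar> * \<bar>t\<bar> ^ k)"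
      by (simp add: abs_mult power_abs field_simps)
    also have "\<dots> \<le> inverse (fact k) * (?M ^ k * \<bar>t\<bar> ^ k)"
      by (intro mult_left_mono mult_right_mono abs_mat_pow_le assms) auto
    finally show ?thesis by (simp add: power_mult_distrib)
  qed
qed

lemma ctmc_trans_powser: "ctmc_trans S Q t x y = (\<Sum>k. mat_pow S Q k x y / fact k * t ^ k)"
  unfolding ctmc_trans_def by (rule suminf_cong) simp

lemma ctmc_trans_0: "ctmc_trans S Q 0 x y = (if x = y then 1 else 0)"
  unfolding ctmc_trans_powser by (subst powser_zero) simp

lemma mean_ctmc_trans_0:
  assumes "finite S" "x \<in> S"
  shows "mean S (ctmc_trans S Q 0 x) f = f x"
  using assms by (simp add: mean_def ctmc_trans_0 if_distrib[of "\<lambda>u. u * _"] cong: if_cong)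

lemma ctmc_trans_has_derivative_powser:
  assumes "finite S" "x \<in> S"
  shows "((\<lambda>t. ctmc_trans S Q t x y) has_real_derivative
           (\<Sum>k. mat_pow S Q (Suc k) x y / fact k * t ^ k)) (at t)"
proof -
  have "diffs (\<lambda>k. mat_pow S Q k x y / fact k) k = mat_pow S Q (Suc k) x y / fact k" for k
    unfolding diffs_def fact_Suc by (simp del: mat_pow.simps of_nat_Suc)
  then show ?thesis
    using termdiffs_strong_converges_everywhere[OF summable_mat_exp[OF assms, of Q y], of t]
    unfolding ctmc_trans_powser by (simp del: mat_pow.simps)
qed

lemma ctmc_trans_backward_equation:
  assumes "finite S" "x \<in> S"
  shows "((\<lambda>t. ctmc_trans S Q t x y) has_real_derivative
           (\<Sum>z\<in>S. Q x z * ctmc_trans S Q t z y)) (at t)"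
proof -
  have "(\<Sum>z\<in>S. Q x z * ctmc_trans S Q t z y)
      = (\<Sum>z\<in>S. \<Sum>k. Q x z * (mat_pow S Q k z y / fact k * t ^ k))"
    unfolding ctmc_trans_powser using assms
    by (intro sum.cong refl suminf_mult[symmetric] summable_mat_exp) auto
  also have "\<dots> = (\<Sum>k. \<Sum>z\<in>S. Q x z * (mat_pow S Q k z y / fact k * t ^ k))"
    using assms by (intro suminf_sum[symmetric] summable_mult summable_mat_exp) auto
  also have "\<dots> = (\<Sum>k. mat_pow S Q (Suc k) x y / fact k * t ^ k)"
    by (simp add: sum_distrib_right sum_divide_distrib mult.assoc)
  finally show ?thesis using ctmc_trans_has_derivative_powser[OF assms, of Q y t] by simp
qed

lemma ctmc_trans_forward_equation:
  assumes "finite S" "x \<in> S" "y \<in> S"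
  shows "((\<lambda>t. ctmc_trans S Q t x y) has_real_derivative
           (\<Sum>z\<in>S. ctmc_trans S Q t x z * Q z y)) (at t)"
proof -
  have "(\<Sum>z\<in>S. ctmc_trans S Q t x z * Q z y)
      = (\<Sum>z\<in>S. \<Sum>k. mat_pow S Q k x z / fact k * t ^ k * Q z y)"
    unfolding ctmc_trans_powser using assms
    by (intro sum.cong refl suminf_mult2 summable_mat_exp) auto
  also have "\<dots> = (\<Sum>k. \<Sum>z\<in>S. mat_pow S Q k x z / fact k * t ^ k * Q z y)"
    using assms by (intro suminf_sum[symmetric] summable_mult2 summable_mat_exp) auto
  also have "\<dots> = (\<Sum>k. mat_pow S Q (Suc k) x y / fact k * t ^ k)"
    unfolding mat_pow_Suc_right[OF assms]
    by (simp add: sum_distrib_left sum_distrib_right sum_divide_distrib mult_ac)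
  finally show ?thesis using ctmc_trans_has_derivative_powser[OF assms(1,2), of Q y t] by simp
qed

lemma mean_ctmc_trans_has_derivative:
  assumes S: "finite S" "x \<in> S"
    and deriv: "\<And>y. y \<in> S \<Longrightarrow> ((\<lambda>s. \<Phi> s y) has_real_derivative \<Phi>' y) (at s)"
  shows "((\<lambda>s. mean S (ctmc_trans S Q s x) (\<Phi> s)) has_real_derivative
           mean S (ctmc_trans S Q s x) (\<lambda>y. \<Phi>' y + (\<Sum>z\<in>S. Q y z * \<Phi> s z))) (at s)"
proof -
  let ?P = "ctmc_trans S Q s x"
  have "(\<Sum>y\<in>S. (\<Sum>z\<in>S. ?P z * Q z y) * \<Phi> s y) = (\<Sum>z\<in>S. \<Sum>y\<in>S. ?P z * Q z y * \<Phi> s y)"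
    unfolding sum_distrib_right by (rule sum.swap)
  then have "(\<Sum>y\<in>S. (\<Sum>z\<in>S. ?P z * Q z y) * \<Phi> s y + \<Phi>' y * ?P y)
      = mean S ?P (\<lambda>y. \<Phi>' y + (\<Sum>z\<in>S. Q y z * \<Phi> s z))"
    by (simp add: mean_def sum.distrib sum_distrib_left distrib_left mult_ac)
  moreover have "((\<lambda>s. mean S (ctmc_trans S Q s x) (\<Phi> s)) has_real_derivative
      (\<Sum>y\<in>S. (\<Sum>z\<in>S. ?P z * Q z y) * \<Phi> s y + \<Phi>' y * ?P y)) (at s)"
    unfolding mean_def by (intro DERIV_sum DERIV_mult ctmc_trans_forward_equation deriv S)
  ultimately show ?thesis by simp
qed

lemma mean_ctmc_trans_space_time_harmonic:
  assumes S: "finite S" "x \<in> S"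
    and deriv: "\<And>s y. y \<in> S \<Longrightarrow> ((\<lambda>s. \<Phi> s y) has_real_derivative - (\<Sum>z\<in>S. Q y z * \<Phi> s z)) (at s)"
  shows "mean S (ctmc_trans S Q T x) (\<Phi> T) = \<Phi> 0 x"
proof -
  have "((\<lambda>s. mean S (ctmc_trans S Q s x) (\<Phi> s)) has_real_derivative 0) (at s)" for s
    using mean_ctmc_trans_has_derivative[where \<Phi> = \<Phi> and Q = Q and s = s, OF S deriv]
    by (simp add: mean_def)
  then have "mean S (ctmc_trans S Q T x) (\<Phi> T) = mean S (ctmc_trans S Q 0 x) (\<Phi> 0)"
    by (intro DERIV_isconst_all) auto
  then show ?thesis using S by (simp add: mean_ctmc_trans_0)
qed

lemma ctmc_trans_add_diagonal:
  fixes Q :: "'s \<Rightarrow> 's \<Rightarrow> real" and k :: real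
  assumes S: "finite S" "x \<in> S" "y \<in> S"
  defines "R \<equiv> \<lambda>x y. Q x y + (if x = y then k else 0)"
  shows "ctmc_trans S Q T x y = exp (- k * T) * ctmc_trans S R T x y"
proof -
  define \<Phi> where "\<Phi> s z = exp (- k * (T - s)) * ctmc_trans S R (T - s) z y" for s z
  have R_apply: "(\<Sum>w\<in>S. R z w * f w) = (\<Sum>w\<in>S. Q z w * f w) + k * f z" if "z \<in> S" for z f
    using S that
    by (simp add: R_def distrib_right sum.distrib if_distrib[of "\<lambda>u. u * _"] cong: if_cong)
  have "((\<lambda>s. \<Phi> s z) has_real_derivative - (\<Sum>w\<in>S. Q z w * \<Phi> s w)) (at s)" if z: "z \<in> S" for s z
  proof -
    let ?e = "exp (- k * (T - s))" and ?W = "\<lambda>z. ctmc_trans S R (T - s) z y"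
    have "((\<lambda>s. ctmc_trans S R (T - s) z y) has_real_derivative (\<Sum>w\<in>S. R z w * ?W w) * (-1)) (at s)"
      by (rule DERIV_chain2[OF ctmc_trans_backward_equation[OF S(1) z]])
        (auto intro!: derivative_eq_intros)
    moreover have "((\<lambda>s. exp (- k * (T - s))) has_real_derivative ?e * k) (at s)"
      by (auto intro!: derivative_eq_intros)
    ultimately have "((\<lambda>s. \<Phi> s z) has_real_derivative
        ?e * k * ?W z + (\<Sum>w\<in>S. R z w * ?W w) * (-1) * ?e) (at s)"
      unfolding \<Phi>_def by (rule DERIV_mult[rotated])
    then show ?thesis
      by (rule DERIV_cong) (simp add: R_apply[OF z] \<Phi>_def algebra_simps sum_distrib_left sum_negf)
  qed
  then have "mean S (ctmc_trans S Q T x) (\<Phi> T) = \<Phi> 0 x"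
    by (rule mean_ctmc_trans_space_time_harmonic[OF S(1,2)])
  then show ?thesis
    using S by (simp add: \<Phi>_def mean_def ctmc_trans_0 if_distrib[of "\<lambda>u. _ * u"] cong: if_cong)
qed

lemma mat_pow_nonneg:
  assumes "\<And>x y. x \<in> S \<Longrightarrow> y \<in> S \<Longrightarrow> Q x y \<ge> 0" "x \<in> S"
  shows "mat_pow S Q k x y \<ge> 0"
  using assms(2) by (induction k arbitrary: x) (auto intro!: sum_nonneg mult_nonneg_nonneg assms(1))

lemma ctmc_trans_nonneg_of_nonneg:
  assumes "finite S" "\<And>x y. x \<in> S \<Longrightarrow> y \<in> S \<Longrightarrow> Q x y \<ge> 0" "x \<in> S" "t \<ge> 0"
  shows "ctmc_trans S Q t x y \<ge> 0"
  unfolding ctmc_trans_powser using assms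
  by (intro suminf_nonneg summable_mat_exp)
    (auto intro!: mult_nonneg_nonneg divide_nonneg_nonneg mat_pow_nonneg)

locale rate_matrix =
  fixes S :: "'s set" and Q :: "'s \<Rightarrow> 's \<Rightarrow> real"
  assumes finite_states: "finite S"
    and off_diagonal_nonneg: "x \<in> S \<Longrightarrow> y \<in> S \<Longrightarrow> x \<noteq> y \<Longrightarrow> 0 \<le> Q x y"
    and row_sum_0: "x \<in> S \<Longrightarrow> (\<Sum>y\<in>S. Q x y) = 0"
begin

lemma ctmc_trans_row_sum: "x \<in> S \<Longrightarrow> (\<Sum>y\<in>S. ctmc_trans S Q t x y) = 1"
  using mean_ctmc_trans_space_time_harmonic[OF finite_states, where \<Phi> = "\<lambda>_ _. 1"]
  by (simp add: mean_def row_sum_0)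

text \<open>Uniformisation: adding a large multiple of the identity makes \<open>Q\<close> entrywise nonnegative.\<close>

lemma ctmc_trans_nonneg:
  assumes "x \<in> S" "y \<in> S" "t \<ge> 0"
  shows "ctmc_trans S Q t x y \<ge> 0"
proof -
  define k where "k = (\<Sum>z\<in>S. \<bar>Q z z\<bar>)"
  have "0 \<le> Q z w + (if z = w then k else 0)" if "z \<in> S" "w \<in> S" for z w
  proof -
    have "\<bar>Q z z\<bar> \<le> k"
      unfolding k_def using that finite_states
      by (intro member_le_sum[where f = "\<lambda>z. \<bar>Q z z\<bar>"]) auto
    then show ?thesis using off_diagonal_nonneg[OF that] by auto
  qed
  then show ?thesis
    using assms finite_states
    by (subst ctmc_trans_add_diagonal[where k = k])
      (auto intro!: mult_nonneg_nonneg ctmc_trans_nonneg_of_nonneg)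
qed

lemma prob_weights_ctmc_trans:
  assumes "x \<in> S" "t \<ge> 0"
  shows "prob_weights S (ctmc_trans S Q t x)"
  using assms by unfold_locales (auto intro: ctmc_trans_nonneg ctmc_trans_row_sum)

lemma mean_ctmc_trans_le_of_drift_le:
  assumes x: "x \<in> S" and T_nonneg: "T \<ge> 0"
    and deriv: "\<And>s y. 0 \<le> s \<Longrightarrow> y \<in> S \<Longrightarrow> ((\<lambda>s. \<Phi> s y) has_real_derivative \<Phi>' s y) (at s)"
    and drift: "\<And>s y. 0 \<le> s \<Longrightarrow> y \<in> S \<Longrightarrow> \<Phi>' s y + (\<Sum>z\<in>S. Q y z * \<Phi> s z) \<le> \<kappa>"
  shows "mean S (ctmc_trans S Q T x) (\<Phi> T) \<le> \<Phi> 0 x + \<kappa> * T"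
proof -
  define g where "g s = mean S (ctmc_trans S Q s x) (\<Phi> s) - \<kappa> * s" for s
  have "g T \<le> g 0"
  proof (rule DERIV_nonpos_imp_nonincreasing[OF T_nonneg])
    fix s :: real assume s: "0 \<le> s"
    let ?d = "mean S (ctmc_trans S Q s x) (\<lambda>y. \<Phi>' s y + (\<Sum>z\<in>S. Q y z * \<Phi> s z)) - \<kappa> * 1"
    have "(g has_real_derivative ?d) (at s)"
      unfolding g_def
      by (intro DERIV_diff DERIV_cmult DERIV_ident mean_ctmc_trans_has_derivative finite_states x
          deriv s)
    moreover have "?d \<le> 0"
      using prob_weights.mean_le_const[OF prob_weights_ctmc_trans[OF x s] drift[OF s]] by simp
    ultimately show "\<exists>d. (g has_real_derivative d) (at s) \<and> d \<le> 0" by blast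
  qed
  then show ?thesis using x finite_states by (simp add: g_def mean_ctmc_trans_0)
qed

end

section \<open>Random subsets\<close>

definition random_subset_prob :: "'a set \<Rightarrow> ('a \<Rightarrow> real) \<Rightarrow> 'a set \<Rightarrow> real" where
  "random_subset_prob A q E = (\<Prod>p\<in>A. if p \<in> E then q p else 1 - q p)"

lemma mean_random_subset_prod:
  assumes "finite A"
  shows "mean (Pow A) (random_subset_prob A q) (\<lambda>E. \<Prod>p\<in>A. if p \<in> E then f p else g p)
    = (\<Prod>p\<in>A. q p * f p + (1 - q p) * g p)"
proof -
  have "random_subset_prob A q E * (\<Prod>p\<in>A. if p \<in> E then f p else g p)
      = (\<Prod>p\<in>E. q p * f p) * (\<Prod>p\<in>A - E. (1 - q p) * g p)" if "E \<in> Pow A" for E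
  proof -
    have "random_subset_prob A q E * (\<Prod>p\<in>A. if p \<in> E then f p else g p)
        = (\<Prod>p\<in>A. if p \<in> E then q p * f p else (1 - q p) * g p)"
      unfolding random_subset_prob_def prod.distrib[symmetric] by (intro prod.cong) auto
    also have "\<dots> = (\<Prod>p\<in>A - E. if p \<in> E then q p * f p else (1 - q p) * g p)
                   * (\<Prod>p\<in>E. if p \<in> E then q p * f p else (1 - q p) * g p)"
      using that assms by (intro prod.subset_diff) auto
    finally show ?thesis by (simp add: mult.commute)
  qed
  then show ?thesis using assms by (simp add: mean_def prod_add)
qed

lemma prob_weights_random_subset:
  assumes "finite A" and q_bounds: "\<And>p. p \<in> A \<Longrightarrow> 0 \<le> q p" "\<And>p. p \<in> A \<Longrightarrow> q p \<le> 1"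
  shows "prob_weights (Pow A) (random_subset_prob A q)"
proof
  show "0 \<le> random_subset_prob A q E" for E
    unfolding random_subset_prob_def using q_bounds by (intro prod_nonneg) simp
  show "sum (random_subset_prob A q) (Pow A) = 1"
    using mean_random_subset_prod[OF assms(1), of q "\<lambda>_. 1" "\<lambda>_. 1"]
    by (simp add: mean_def cong: if_cong)
qed

lemma exp_le_one_plus_plus_square:
  fixes x :: real
  assumes "\<bar>x\<bar> \<le> 1"
  shows "exp x \<le> 1 + x + x\<^sup>2"
proof (cases "x \<ge> 0")
  case True
  then show ?thesis using exp_bound assms by auto
next
  case False
  have "1 \<le> (1 + x + x\<^sup>2) * (1 - x)"
    using False
    by (simp add: algebra_simps power2_eq_square mult_nonneg_nonpos zero_le_mult_iff mult_le_0_iff)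
  also have "\<dots> \<le> (1 + x + x\<^sup>2) * exp (- x)"
    using exp_ge_add_one_self[of "- x"] assms by (intro mult_left_mono) auto
  finally show ?thesis by (simp add: exp_minus field_simps)
qed

lemma centred_bernoulli_mgf_le:
  fixes q \<theta> :: real
  assumes "0 \<le> q" "\<bar>\<theta>\<bar> \<le> 1"
  shows "q * exp (\<theta> * (1 - q)) + (1 - q) * exp (\<theta> * (0 - q)) \<le> exp (q * \<theta>\<^sup>2)"
proof -
  have "q * exp (\<theta> * (1 - q)) + (1 - q) * exp (\<theta> * (0 - q)) = exp (- \<theta> * q) * (1 + q * (exp \<theta> - 1))"
    by (simp add: right_diff_distrib distrib_left exp_diff exp_minus field_simps)
  also have "\<dots> \<le> exp (- \<theta> * q) * exp (q * (exp \<theta> - 1))"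
    by (intro mult_left_mono exp_ge_add_one_self) auto
  also have "\<dots> = exp (q * (exp \<theta> - 1 - \<theta>))"
    by (simp add: exp_add[symmetric] algebra_simps)
  also have "\<dots> \<le> exp (q * \<theta>\<^sup>2)"
    using exp_le_one_plus_plus_square[OF assms(2)] assms(1) by (auto intro!: mult_left_mono)
  finally show ?thesis .
qed

lemma random_subset_mgf_le:
  assumes "finite A" and q_bounds: "\<And>p. p \<in> A \<Longrightarrow> 0 \<le> q p" "\<And>p. p \<in> A \<Longrightarrow> q p \<le> 1"
    and w_le: "\<And>p. p \<in> A \<Longrightarrow> \<bar>w p\<bar> \<le> 1"
  shows "mean (Pow A) (random_subset_prob A q)
      (\<lambda>E. exp (\<Sum>p\<in>A. w p * ((if p \<in> E then 1 else 0) - q p))) \<le> exp (\<Sum>p\<in>A. q p * (w p)\<^sup>2)"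
proof -
  have "exp (\<Sum>p\<in>A. w p * ((if p \<in> E then 1 else 0) - q p))
      = (\<Prod>p\<in>A. if p \<in> E then exp (w p * (1 - q p)) else exp (w p * (0 - q p)))" for E
    unfolding exp_sum[OF assms(1)] by (intro prod.cong) auto
  then have "mean (Pow A) (random_subset_prob A q)
        (\<lambda>E. exp (\<Sum>p\<in>A. w p * ((if p \<in> E then 1 else 0) - q p)))
      = (\<Prod>p\<in>A. q p * exp (w p * (1 - q p)) + (1 - q p) * exp (w p * (0 - q p)))"
    by (simp only: mean_random_subset_prod[OF assms(1)])
  also have "\<dots> \<le> (\<Prod>p\<in>A. exp (q p * (w p)\<^sup>2))"
    using q_bounds w_le
    by (intro prod_mono conjI centred_bernoulli_mgf_le add_nonneg_nonneg mult_nonneg_nonneg) auto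
  also have "\<dots> = exp (\<Sum>p\<in>A. q p * (w p)\<^sup>2)" by (rule exp_sum[OF assms(1), symmetric])
  finally show ?thesis .
qed

section \<open>Uniform concentration of random graphs\<close>

lemma finite_configs [simp]: "finite (configs N)"
  unfolding configs_def by (intro finite_PiE) auto

lemma card_configs: "card (configs N) = 2 ^ N"
  unfolding configs_def by (subst card_PiE) (auto simp: numeral_2_eq_2)

lemma configs_values:
  assumes "\<sigma> \<in> configs N" "u < N"
  shows "\<sigma> u = 1 \<or> \<sigma> u = -1"
  using assms unfolding configs_def by (auto dest!: PiE_mem[of _ _ _ u])

lemma abs_configs [simp]:
  assumes "\<sigma> \<in> configs N" "u < N"
  shows "\<bar>\<sigma> u\<bar> = 1"
  using configs_values[OF assms] by auto

lemma finite_pairs [simp]: "finite (pairs N)"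
  by (rule finite_subset[of _ "{..<N} \<times> {..<N}"]) (auto simp: pairs_def)

lemma card_pairs_le: "card (pairs N) \<le> N\<^sup>2"
proof -
  have "card (pairs N) \<le> card ({..<N} \<times> {..<N})"
    by (intro card_mono) (auto simp: pairs_def)
  then show ?thesis by (simp add: power2_eq_square)
qed

lemma graph_prob_eq_random_subset_prob:
  "graph_prob N V1 pin pout = random_subset_prob (pairs N) (edge_prob V1 pin pout)"
  by (simp add: fun_eq_iff graph_prob_def random_subset_prob_def)

definition noise :: "nat \<Rightarrow> (nat \<times> nat \<Rightarrow> real) \<Rightarrow> (nat \<times> nat) set \<Rightarrow> (nat \<Rightarrow> real) \<Rightarrow> nat \<Rightarrow> real" where
  "noise N q E \<sigma> u =
     (\<Sum>v\<in>{0..<N} - {u}. ((if adj E u v then 1 else 0) - q (min u v, max u v)) * \<sigma> v)"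

definition low_noise :: "nat \<Rightarrow> (nat \<times> nat \<Rightarrow> real) \<Rightarrow> real \<Rightarrow> (nat \<times> nat) set \<Rightarrow> bool" where
  "low_noise N q s E \<longleftrightarrow> (\<forall>\<sigma>\<in>configs N. (\<Sum>u<N. \<bar>noise N q E \<sigma> u\<bar>) \<le> s)"

lemma sum_off_diagonal:
  fixes F :: "nat \<Rightarrow> nat \<Rightarrow> 'a :: comm_monoid_add"
  shows "(\<Sum>u<N. \<Sum>v\<in>{0..<N} - {u}. F u v) = (\<Sum>p\<in>pairs N. F (fst p) (snd p) + F (snd p) (fst p))"
proof -
  have "(\<Sum>u<N. \<Sum>v\<in>{0..<N} - {u}. F u v) = (\<Sum>p\<in>(SIGMA u:{..<N}. {0..<N} - {u}). F (fst p) (snd p))"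
    by (subst sum.Sigma) (auto simp: case_prod_unfold)
  also have "(SIGMA u:{..<N}. {0..<N} - {u}) = pairs N \<union> prod.swap ` pairs N"
    by (auto simp: pairs_def image_iff)
  also have "(\<Sum>p\<in>pairs N \<union> prod.swap ` pairs N. F (fst p) (snd p))
      = (\<Sum>p\<in>pairs N. F (fst p) (snd p)) + (\<Sum>p\<in>prod.swap ` pairs N. F (fst p) (snd p))"
    by (intro sum.union_disjoint finite_imageI finite_pairs) (auto simp: pairs_def)
  also have "(\<Sum>p\<in>prod.swap ` pairs N. F (fst p) (snd p)) = (\<Sum>p\<in>pairs N. F (snd p) (fst p))"
    by (subst sum.reindex) (auto simp: inj_on_def)
  finally show ?thesis by (simp add: sum.distrib)
qed

lemma noise_bilinear_form:
  "(\<Sum>u<N. x u * noise N q E y u) =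
   (\<Sum>p\<in>pairs N. (x (fst p) * y (snd p) + x (snd p) * y (fst p)) * ((if p \<in> E then 1 else 0) - q p))"
proof -
  let ?d = "\<lambda>u v. (if adj E u v then 1 else 0) - q (min u v, max u v)"
  have "(\<Sum>u<N. x u * noise N q E y u) = (\<Sum>u<N. \<Sum>v\<in>{0..<N} - {u}. x u * ?d u v * y v)"
    by (simp add: noise_def sum_distrib_left mult.assoc)
  also have "\<dots> = (\<Sum>p\<in>pairs N. x (fst p) * ?d (fst p) (snd p) * y (snd p)
                               + x (snd p) * ?d (snd p) (fst p) * y (fst p))"
    by (rule sum_off_diagonal)
  also have "\<dots> = (\<Sum>p\<in>pairs N. (x (fst p) * y (snd p) + x (snd p) * y (fst p)) *
      ((if p \<in> E then 1 else 0) - q p))"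
    by (intro sum.cong) (auto simp: pairs_def adj_def algebra_simps)
  finally show ?thesis .
qed

lemma noise_bilinear_form_mgf_le:
  assumes q_bounds: "\<And>p. 0 \<le> q p" "\<And>p. q p \<le> r" "r \<le> 1" and \<theta>_bounds: "0 \<le> \<theta>" "\<theta> \<le> 1/2"
    and x: "x \<in> configs N" and y: "y \<in> configs N"
  shows "mean (Pow (pairs N)) (random_subset_prob (pairs N) q)
      (\<lambda>E. exp (\<theta> * (\<Sum>u<N. x u * noise N q E y u))) \<le> exp (4 * \<theta>\<^sup>2 * r * real N ^ 2)"
proof -
  define w where "w p = \<theta> * (x (fst p) * y (snd p) + x (snd p) * y (fst p))" for p
  have w_le: "\<bar>w p\<bar> \<le> 2 * \<theta>" if "p \<in> pairs N" for p
  proof -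
    have "fst p < N" "snd p < N" using that by (auto simp: pairs_def)
    then have "\<bar>x (fst p) * y (snd p) + x (snd p) * y (fst p)\<bar> \<le> 2"
      using abs_triangle_ineq[of "x (fst p) * y (snd p)" "x (snd p) * y (fst p)"] x y
      by (simp add: abs_mult)
    then show ?thesis using \<theta>_bounds unfolding w_def
      by (simp add: abs_mult mult_left_mono mult.commute[of 2])
  qed
  have "mean (Pow (pairs N)) (random_subset_prob (pairs N) q)
        (\<lambda>E. exp (\<theta> * (\<Sum>u<N. x u * noise N q E y u)))
      = mean (Pow (pairs N)) (random_subset_prob (pairs N) q)
          (\<lambda>E. exp (\<Sum>p\<in>pairs N. w p * ((if p \<in> E then 1 else 0) - q p)))"
    unfolding noise_bilinear_form sum_distrib_left w_def mult.assoc ..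
  also have "\<dots> \<le> exp (\<Sum>p\<in>pairs N. q p * (w p)\<^sup>2)"
  proof (intro random_subset_mgf_le finite_pairs q_bounds(1))
    show "q p \<le> 1" for p using q_bounds(2)[of p] q_bounds(3) by linarith
    show "\<bar>w p\<bar> \<le> 1" if "p \<in> pairs N" for p using w_le[OF that] \<theta>_bounds(2) by linarith
  qed
  also have "(\<Sum>p\<in>pairs N. q p * (w p)\<^sup>2) \<le> (\<Sum>p\<in>pairs N. r * (2 * \<theta>)\<^sup>2)"
    using q_bounds order_trans[OF q_bounds(1,2)] power_mono[OF w_le, of _ 2]
    by (intro sum_mono mult_mono) auto
  also have "\<dots> = 4 * \<theta>\<^sup>2 * r * real (card (pairs N))" by (simp add: power_mult_distrib)
  also have "\<dots> \<le> 4 * \<theta>\<^sup>2 * r * real N ^ 2"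
    using order_trans[OF q_bounds(1,2)] card_pairs_le[of N]
    by (intro mult_left_mono) (auto simp flip: of_nat_power)
  finally show ?thesis by simp
qed

text \<open>Pairing the noise with its own sign pattern turns its \<open>\<ell>\<^sub>1\<close> norm into a bilinear form in two
  sign vectors, so a union bound over these controls it for all configurations at once.\<close>

lemma not_low_noise_le_sum_exp:
  assumes "0 \<le> \<theta>"
  shows "(if low_noise N q s E then 0 else 1)
    \<le> exp (- \<theta> * s) * (\<Sum>x\<in>configs N. \<Sum>y\<in>configs N. exp (\<theta> * (\<Sum>u<N. x u * noise N q E y u)))"
    (is "_ \<le> _ * (\<Sum>x\<in>_. \<Sum>y\<in>_. ?e x y)")
proof (cases "low_noise N q s E")
  case True
  then show ?thesis by (auto intro!: mult_nonneg_nonneg sum_nonneg)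
next
  case False
  then obtain y where y: "y \<in> configs N" "s < (\<Sum>u<N. \<bar>noise N q E y u\<bar>)"
    by (auto simp: low_noise_def not_le)
  define x where "x = (\<lambda>u\<in>{0..<N}. if noise N q E y u \<ge> 0 then 1 else (-1::real))"
  have x: "x \<in> configs N" by (auto simp: x_def configs_def)
  have "(\<Sum>u<N. x u * noise N q E y u) = (\<Sum>u<N. \<bar>noise N q E y u\<bar>)"
    by (intro sum.cong) (auto simp: x_def)
  then have "1 \<le> exp (- \<theta> * s) * ?e x y"
    using y(2) assms by (simp add: mult_left_mono flip: exp_add)
  also have "?e x y \<le> (\<Sum>y\<in>configs N. ?e x y)"
    using y by (intro member_le_sum[where f = "?e x"]) auto
  also have "\<dots> \<le> (\<Sum>x\<in>configs N. \<Sum>y\<in>configs N. ?e x y)"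
    using x by (intro member_le_sum[where f = "\<lambda>x. \<Sum>y\<in>configs N. ?e x y"] sum_nonneg) auto
  finally show ?thesis using False by simp
qed

lemma prob_not_low_noise_le:
  assumes q_bounds: "\<And>p. 0 \<le> q p" "\<And>p. q p \<le> r" "r \<le> 1" and \<theta>_bounds: "0 \<le> \<theta>" "\<theta> \<le> 1/2"
  shows "mean (Pow (pairs N)) (random_subset_prob (pairs N) q)
      (\<lambda>E. if low_noise N q s E then 0 else 1)
    \<le> 4 ^ N * exp (4 * \<theta>\<^sup>2 * r * real N ^ 2 - \<theta> * s)"
proof -
  let ?E = "mean (Pow (pairs N)) (random_subset_prob (pairs N) q)"
  let ?e = "\<lambda>x y E. exp (\<theta> * (\<Sum>u<N. x u * noise N q E y u))"
  interpret prob_weights "Pow (pairs N)" "random_subset_prob (pairs N) q"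
    using q_bounds order_trans[OF q_bounds(2) q_bounds(3)]
    by (intro prob_weights_random_subset) auto
  have "?E (\<lambda>E. if low_noise N q s E then 0 else 1)
      \<le> ?E (\<lambda>E. exp (- \<theta> * s) * (\<Sum>x\<in>configs N. \<Sum>y\<in>configs N. ?e x y E))"
    by (intro mean_mono not_low_noise_le_sum_exp \<theta>_bounds)
  also have "\<dots> = exp (- \<theta> * s) * (\<Sum>x\<in>configs N. \<Sum>y\<in>configs N. ?E (?e x y))"
    by (simp only: mean_cmult mean_sum)
  also have "\<dots> \<le> exp (- \<theta> * s) * (\<Sum>x\<in>configs N. \<Sum>y\<in>configs N. exp (4 * \<theta>\<^sup>2 * r * real N ^ 2))"
    by (intro mult_left_mono sum_mono noise_bilinear_form_mgf_le q_bounds \<theta>_bounds) auto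
  also have "\<dots> = 4 ^ N * exp (4 * \<theta>\<^sup>2 * r * real N ^ 2 - \<theta> * s)"
    by (simp add: card_configs exp_diff exp_minus field_simps flip: power_mult_distrib)
  finally show ?thesis .
qed

section \<open>Independent initial spins\<close>

definition product_weight :: "'i set \<Rightarrow> ('i \<Rightarrow> 'a \<Rightarrow> real) \<Rightarrow> ('i \<Rightarrow> 'a) \<Rightarrow> real" where
  "product_weight I w \<sigma> = (\<Prod>u\<in>I. w u (\<sigma> u))"

locale independent_coordinates =
  fixes I :: "'i set" and S :: "'i \<Rightarrow> 'a set" and w :: "'i \<Rightarrow> 'a \<Rightarrow> real"
  assumes finite_indices: "finite I" and finite_values: "u \<in> I \<Longrightarrow> finite (S u)"
    and weights: "u \<in> I \<Longrightarrow> prob_weights (S u) (w u)"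
begin

lemma mean_prod:
  assumes "J \<subseteq> I"
  shows "mean (PiE I S) (product_weight I w) (\<lambda>\<sigma>. \<Prod>u\<in>J. f u (\<sigma> u)) = (\<Prod>u\<in>J. mean (S u) (w u) (f u))"
proof -
  define g where "g u = (if u \<in> J then f u else (\<lambda>_. 1))" for u
  have "(\<Prod>u\<in>J. f u (\<sigma> u)) = (\<Prod>u\<in>I. g u (\<sigma> u))" for \<sigma>
    using assms finite_indices by (intro prod.mono_neutral_cong_left) (auto simp: g_def)
  then have "mean (PiE I S) (product_weight I w) (\<lambda>\<sigma>. \<Prod>u\<in>J. f u (\<sigma> u))
      = (\<Sum>\<sigma>\<in>PiE I S. \<Prod>u\<in>I. w u (\<sigma> u) * g u (\<sigma> u))"
    by (simp add: mean_def product_weight_def prod.distrib)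
  also have "\<dots> = (\<Prod>u\<in>I. mean (S u) (w u) (g u))"
    using finite_indices finite_values unfolding mean_def by (subst prod_sum_PiE) auto
  also have "\<dots> = (\<Prod>u\<in>J. mean (S u) (w u) (f u))"
    using assms finite_indices prob_weights.mean_const[OF weights]
    by (intro prod.mono_neutral_cong_right) (auto simp: g_def)
  finally show ?thesis .
qed

sublocale prob_weights "PiE I S" "product_weight I w"
proof
  show "0 \<le> product_weight I w \<sigma>" if "\<sigma> \<in> PiE I S" for \<sigma>
    unfolding product_weight_def using that weights
    by (intro prod_nonneg) (auto intro: prob_weights.nonneg dest: PiE_mem)
  show "sum (product_weight I w) (PiE I S) = 1"
    using mean_prod[of "{}"] by (simp add: mean_def)
qed

lemma mean_square_sum:
  assumes "A \<subseteq> I" and centred: "\<And>u. u \<in> A \<Longrightarrow> mean (S u) (w u) (f u) = 0"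
  shows "mean (PiE I S) (product_weight I w) (\<lambda>\<sigma>. (\<Sum>u\<in>A. f u (\<sigma> u))\<^sup>2)
    = (\<Sum>u\<in>A. mean (S u) (w u) (\<lambda>y. (f u y)\<^sup>2))"
proof -
  let ?E = "mean (PiE I S) (product_weight I w)"
  have "finite A" using assms(1) finite_indices finite_subset by blast
  have covariance: "?E (\<lambda>\<sigma>. f u (\<sigma> u) * f v (\<sigma> v))
      = (if u = v then mean (S u) (w u) (\<lambda>y. (f u y)\<^sup>2) else 0)" if "u \<in> A" "v \<in> A" for u v
  proof (cases "u = v")
    case True
    then show ?thesis
      using mean_prod[of "{u}" "\<lambda>u y. (f u y)\<^sup>2"] that assms(1) by (auto simp: power2_eq_square)
  next
    case False
    then show ?thesis
      using mean_prod[of "{u, v}" f] that assms(1) by (auto simp: centred)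
  qed
  have "?E (\<lambda>\<sigma>. (\<Sum>u\<in>A. f u (\<sigma> u))\<^sup>2) = (\<Sum>u\<in>A. \<Sum>v\<in>A. ?E (\<lambda>\<sigma>. f u (\<sigma> u) * f v (\<sigma> v)))"
    by (simp only: power2_eq_square sum_product mean_sum)
  then show ?thesis using \<open>finite A\<close> by (simp add: covariance)
qed

end

section \<open>Drift of the community magnetisations\<close>

lemma magnet_flip:
  assumes "finite A"
  shows "magnet A (flip s u) = magnet A s - (if u \<in> A then 2 * s u / card A else 0)"
proof (cases "u \<in> A")
  case True
  have "(\<Sum>v\<in>A. flip s u v) = flip s u u + (\<Sum>v\<in>A - {u}. flip s u v)"
    using assms True by (rule sum.remove)
  also have "(\<Sum>v\<in>A - {u}. flip s u v) = (\<Sum>v\<in>A - {u}. s v)"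
    by (intro sum.cong) (auto simp: flip_def)
  also have "\<dots> = (\<Sum>v\<in>A. s v) - s u"
    using assms True by (simp add: sum_diff1)
  finally show ?thesis
    using True by (simp add: magnet_def flip_def diff_divide_distrib)
next
  case False
  then have "(\<Sum>v\<in>A. flip s u v) = (\<Sum>v\<in>A. s v)"
    by (intro sum.cong) (auto simp: flip_def)
  then show ?thesis using False by (simp add: magnet_def)
qed

lemma abs_magnet_le:
  assumes "\<And>u. u \<in> A \<Longrightarrow> \<bar>s u\<bar> \<le> K" "0 \<le> K"
  shows "\<bar>magnet A s\<bar> \<le> K"
proof -
  have "\<bar>\<Sum>u\<in>A. s u\<bar> \<le> real (card A) * K"
    using order_trans[OF sum_abs sum_bounded_above[of A "\<lambda>u. \<bar>s u\<bar>" K]] assms by simp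
  then show ?thesis
    using assms(2) by (cases "card A = 0") (auto simp: magnet_def abs_divide field_simps)
qed

definition rate_error :: "(nat \<Rightarrow> real) \<Rightarrow> (nat \<Rightarrow> real) \<Rightarrow> nat \<Rightarrow> real" where
  "rate_error r s u = \<bar>r u - (1 - s u) / 2\<bar>"

lemma magnet_drift_approx:
  assumes A: "finite A" "A \<noteq> {}" and spins: "\<And>u. u \<in> A \<Longrightarrow> s u = 1 \<or> s u = -1"
  shows "\<bar>(\<Sum>u\<in>A. r u * (magnet A (flip s u) - magnet A s)) - (1 - magnet A s)\<bar>
    \<le> 2 * magnet A (rate_error r s)"
proof -
  let ?V = "real (card A)"
  have V_pos: "?V > 0" using A by (simp add: card_gt_0_iff)
  have "(\<Sum>u\<in>A. r u * (magnet A (flip s u) - magnet A s)) = (\<Sum>u\<in>A. r u * (- 2 * s u)) / ?V"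
    unfolding sum_divide_distrib using A by (intro sum.cong refl) (simp add: magnet_flip)
  moreover have "1 - magnet A s = (\<Sum>u\<in>A. 1 - s u) / ?V"
    using V_pos by (simp add: magnet_def sum_subtractf diff_divide_distrib)
  ultimately have "(\<Sum>u\<in>A. r u * (magnet A (flip s u) - magnet A s)) - (1 - magnet A s)
      = (\<Sum>u\<in>A. r u * (- 2 * s u) - (1 - s u)) / ?V"
    by (simp add: sum_subtractf diff_divide_distrib)
  moreover have "\<bar>\<Sum>u\<in>A. r u * (- 2 * s u) - (1 - s u)\<bar> \<le> (\<Sum>u\<in>A. 2 * rate_error r s u)"
  proof (intro order_trans[OF sum_abs] sum_mono)
    fix u assume "u \<in> A"
    from spins[OF this] show "\<bar>r u * (- 2 * s u) - (1 - s u)\<bar> \<le> 2 * rate_error r s u"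
      by (auto simp: rate_error_def abs_if)
  qed
  ultimately show ?thesis
    using V_pos by (simp add: magnet_def abs_divide divide_right_mono flip: sum_distrib_left)
qed

lemma community_square_drift_le:
  assumes A: "finite A" "A \<noteq> {}" and spins: "\<And>u. u \<in> A \<Longrightarrow> s u = 1 \<or> s u = -1"
    and rates: "\<And>u. u \<in> A \<Longrightarrow> r u \<le> 1"
  shows "(\<Sum>u\<in>A. r u * ((magnet A (flip s u) - m)\<^sup>2 - (magnet A s - m)\<^sup>2))
    \<le> 2 * (1 - m) * (magnet A s - m) + 4 * (magnet A (rate_error r s))\<^sup>2 + 4 / card A"
proof -
  let ?V = "real (card A)" and ?X = "magnet A s - m"
  have V_pos: "?V > 0" using A by (simp add: card_gt_0_iff)
  define d where "d = (\<Sum>u\<in>A. r u * (magnet A (flip s u) - magnet A s)) - (1 - magnet A s)"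
  have "(magnet A (flip s u) - m)\<^sup>2 - ?X\<^sup>2 = 2 * ?X * (magnet A (flip s u) - magnet A s) + 4 / ?V\<^sup>2"
    if "u \<in> A" for u
    using spins[OF that] that A by (auto simp: magnet_flip power2_eq_square field_simps)
  then have "(\<Sum>u\<in>A. r u * ((magnet A (flip s u) - m)\<^sup>2 - ?X\<^sup>2))
      = 2 * ?X * (\<Sum>u\<in>A. r u * (magnet A (flip s u) - magnet A s)) + sum r A * (4 / ?V\<^sup>2)"
    by (simp add: sum_distrib_left sum_distrib_right sum_divide_distrib sum.distrib distrib_left
        mult_ac)
  also have "\<dots> = 2 * ?X * (1 - m - ?X + d) + sum r A * (4 / ?V\<^sup>2)"
    by (simp add: d_def)
  also have "\<dots> \<le> 2 * ?X * (1 - m - ?X + d) + ?V * (4 / ?V\<^sup>2)"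
    using sum_bounded_above[of A r 1] rates by (intro add_left_mono mult_right_mono) auto
  also have "\<dots> = 2 * (1 - m) * ?X + d\<^sup>2 - ?X\<^sup>2 - (?X - d)\<^sup>2 + 4 / ?V"
    using V_pos by (simp add: power2_eq_square algebra_simps)
  also have "\<dots> \<le> 2 * (1 - m) * ?X + d\<^sup>2 + 4 / ?V" by simp
  also have "d\<^sup>2 \<le> (2 * magnet A (rate_error r s))\<^sup>2"
    using power_mono[OF magnet_drift_approx[where r = r, OF A spins], where n = 2]
    by (simp add: d_def)
  finally show ?thesis by (simp add: power_mult_distrib)
qed

definition magnet_dist2 :: "nat set set \<Rightarrow> real \<Rightarrow> (nat \<Rightarrow> real) \<Rightarrow> real" where
  "magnet_dist2 \<C> m s = (\<Sum>A\<in>\<C>. (magnet A s - m)\<^sup>2)"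

lemma magnet_dist2_nonneg: "0 \<le> magnet_dist2 \<C> m s"
  by (simp add: magnet_dist2_def sum_nonneg)

lemma abs_magnet_diff_le_sqrt_dist2:
  assumes "finite \<C>" "A \<in> \<C>"
  shows "\<bar>magnet A s - m\<bar> \<le> sqrt (magnet_dist2 \<C> m s)"
  using member_le_sum[OF assms(2) _ assms(1), of "\<lambda>A. (magnet A s - m)\<^sup>2"]
  by (simp add: magnet_dist2_def real_le_rsqrt)

definition relaxation :: "real \<Rightarrow> real \<Rightarrow> real" where
  "relaxation \<eta> t = 1 - (1 - \<eta>) * exp (- t)"

lemma relaxation_bounds:
  assumes "\<eta> \<le> 1" "0 \<le> t"
  shows "\<eta> \<le> relaxation \<eta> t" "relaxation \<eta> t \<le> 1"
  using assms mult_left_mono[of "exp (- t)" 1 "1 - \<eta>"] by (auto simp: relaxation_def)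

definition lyapunov :: "nat set set \<Rightarrow> real \<Rightarrow> real \<Rightarrow> real \<Rightarrow> (nat \<Rightarrow> real) \<Rightarrow> real" where
  "lyapunov \<C> k \<eta> t s = 1 - exp (- k * magnet_dist2 \<C> (relaxation \<eta> t) s)"

lemma lyapunov_has_derivative:
  "((\<lambda>t. lyapunov \<C> k \<eta> t s) has_real_derivative
     - (k * exp (- k * magnet_dist2 \<C> (relaxation \<eta> t) s) *
        (\<Sum>A\<in>\<C>. 2 * (1 - relaxation \<eta> t) * (magnet A s - relaxation \<eta> t)))) (at t)"
proof -
  let ?m = "relaxation \<eta>"
  have m: "(?m has_real_derivative 1 - ?m t) (at t)"
    unfolding relaxation_def by (auto intro!: derivative_eq_intros)
  have "((\<lambda>t. (magnet A s - ?m t)\<^sup>2) has_real_derivative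
      - (2 * (1 - ?m t) * (magnet A s - ?m t))) (at t)"
    for A by (auto intro!: derivative_eq_intros m simp: algebra_simps)
  then have "((\<lambda>t. magnet_dist2 \<C> (?m t) s) has_real_derivative
      - (\<Sum>A\<in>\<C>. 2 * (1 - ?m t) * (magnet A s - ?m t))) (at t)"
    unfolding magnet_dist2_def sum_negf[symmetric] by (intro DERIV_sum)
  then show ?thesis
    unfolding lyapunov_def by (auto intro!: derivative_eq_intros)
qed

lemma lyapunov_nonneg: "0 \<le> k \<Longrightarrow> 0 \<le> lyapunov \<C> k \<eta> t s"
  by (simp add: lyapunov_def magnet_dist2_nonneg)

lemma lyapunov_le_1: "lyapunov \<C> k \<eta> t s \<le> 1"
  by (simp add: lyapunov_def)

lemma lyapunov_0_le: "lyapunov \<C> k \<eta> 0 s \<le> k * magnet_dist2 \<C> \<eta> s"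
  using exp_ge_add_one_self[of "- k * magnet_dist2 \<C> \<eta> s"]
  by (simp add: lyapunov_def relaxation_def)

lemma one_minus_exp_increment_le:
  fixes k x y :: real
  shows "(1 - exp (- k * y)) - (1 - exp (- k * x)) \<le> k * exp (- k * x) * (y - x)"
proof -
  have "exp (- k * x) * (1 + - k * (y - x)) \<le> exp (- k * x) * exp (- k * (y - x))"
    by (intro mult_left_mono exp_ge_add_one_self) auto
  also have "\<dots> = exp (- k * y)" by (simp add: exp_add[symmetric] algebra_simps)
  finally show ?thesis by (simp add: algebra_simps)
qed

definition drift_bound :: "nat set set \<Rightarrow> real \<Rightarrow> real \<Rightarrow> real \<Rightarrow> real" where
  "drift_bound \<C> k \<rho> \<delta> =
     k * (\<Sum>A\<in>\<C>. 4 * (\<delta> / card A)\<^sup>2 + 4 / card A) + 8 * real (card \<C>) * k * exp (- k * \<rho>\<^sup>2)"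

locale community_partition =
  fixes U :: "nat set" and \<C> :: "nat set set"
  assumes finite_nodes: "finite U" and partition: "partition_on U \<C>"
begin

lemma finite_communities: "finite \<C>"
  by (rule finite_elements[OF finite_nodes partition])

lemma finite_community: "A \<in> \<C> \<Longrightarrow> finite A"
  using finite_nodes partition_onD1[OF partition] by (auto intro: finite_subset)

lemma community_nonempty: "A \<in> \<C> \<Longrightarrow> A \<noteq> {}"
  using partition_onD3[OF partition] by auto

lemma sum_nodes: "(\<Sum>u\<in>U. f u) = (\<Sum>A\<in>\<C>. \<Sum>u\<in>A. f u)"
  unfolding partition_onD1[OF partition]
  using finite_community partition_onD2[OF partition]
  by (subst sum.Union_disjoint) (auto simp: disjoint_def)

lemma magnet_dist2_flip:
  assumes "A \<in> \<C>" "u \<in> A"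
  shows "magnet_dist2 \<C> m (flip s u) - magnet_dist2 \<C> m s
    = (magnet A (flip s u) - m)\<^sup>2 - (magnet A s - m)\<^sup>2"
proof -
  have "u \<notin> B" if "B \<in> \<C> - {A}" for B
    using partition_onD2[OF partition] assms that by (auto simp: disjoint_def)
  then have "(\<Sum>B\<in>\<C> - {A}. (magnet B (flip s u) - m)\<^sup>2) = (\<Sum>B\<in>\<C> - {A}. (magnet B s - m)\<^sup>2)"
    by (intro sum.cong refl) (simp add: magnet_flip finite_community)
  then show ?thesis
    unfolding magnet_dist2_def using assms finite_communities
    by (simp add: sum.remove[of \<C> A])
qed

lemma magnet_dist2_drift_le:
  assumes spins: "\<And>u. u \<in> U \<Longrightarrow> s u = 1 \<or> s u = -1" and rates: "\<And>u. u \<in> U \<Longrightarrow> r u \<le> 1"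
  shows "(\<Sum>u\<in>U. r u * (magnet_dist2 \<C> m (flip s u) - magnet_dist2 \<C> m s))
    \<le> (\<Sum>A\<in>\<C>. 2 * (1 - m) * (magnet A s - m))
      + (\<Sum>A\<in>\<C>. 4 * (magnet A (rate_error r s))\<^sup>2 + 4 / card A)"
proof -
  have "(\<Sum>u\<in>U. r u * (magnet_dist2 \<C> m (flip s u) - magnet_dist2 \<C> m s))
      = (\<Sum>A\<in>\<C>. \<Sum>u\<in>A. r u * ((magnet A (flip s u) - m)\<^sup>2 - (magnet A s - m)\<^sup>2))"
    unfolding sum_nodes by (intro sum.cong refl) (simp add: magnet_dist2_flip)
  also have "\<dots> \<le> (\<Sum>A\<in>\<C>. 2 * (1 - m) * (magnet A s - m)
      + 4 * (magnet A (rate_error r s))\<^sup>2 + 4 / card A)"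
    using spins rates partition_onD1[OF partition]
    by (intro sum_mono community_square_drift_le finite_community community_nonempty) auto
  finally show ?thesis by (simp add: sum.distrib add.assoc)
qed

lemma community_rate_error_le:
  assumes spins: "\<And>u. u \<in> U \<Longrightarrow> s u = 1 \<or> s u = -1"
    and rates: "\<And>u. u \<in> U \<Longrightarrow> 0 \<le> r u" "\<And>u. u \<in> U \<Longrightarrow> r u \<le> 1" and A: "A \<in> \<C>"
  shows "\<bar>magnet A (rate_error r s)\<bar> \<le> 1"
proof (rule abs_magnet_le)
  fix u assume "u \<in> A"
  then have "u \<in> U" using A partition_onD1[OF partition] by auto
  then show "\<bar>rate_error r s u\<bar> \<le> 1"
    using spins[of u] rates[of u] by (auto simp: rate_error_def)
qed simp

lemma abs_community_rate_error_le_total: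
  assumes A: "A \<in> \<C>"
  shows "\<bar>magnet A (rate_error r s)\<bar> \<le> (\<Sum>u\<in>U. rate_error r s u) / card A"
proof -
  have "\<bar>\<Sum>u\<in>A. rate_error r s u\<bar> = (\<Sum>u\<in>A. rate_error r s u)"
    by (simp add: rate_error_def sum_nonneg)
  also have "\<dots> \<le> (\<Sum>u\<in>U. rate_error r s u)"
    using A partition_onD1[OF partition] finite_nodes
    by (intro sum_mono2) (auto simp: rate_error_def)
  finally show ?thesis by (simp add: magnet_def abs_divide divide_right_mono)
qed

lemma sum_square_rate_error_le_total:
  assumes total: "(\<Sum>u\<in>U. rate_error r s u) \<le> \<delta>"
  shows "(\<Sum>A\<in>\<C>. 4 * (magnet A (rate_error r s))\<^sup>2 + 4 / card A)
    \<le> (\<Sum>A\<in>\<C>. 4 * (\<delta> / card A)\<^sup>2 + 4 / card A)"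
proof (intro sum_mono add_right_mono mult_left_mono)
  fix A assume "A \<in> \<C>"
  then have "\<bar>magnet A (rate_error r s)\<bar> \<le> \<delta> / card A"
    using abs_community_rate_error_le_total[of A r s] total
    by (meson divide_right_mono of_nat_0_le_iff order_trans)
  from power_mono[OF this, of 2] show "(magnet A (rate_error r s))\<^sup>2 \<le> (\<delta> / card A)\<^sup>2" by simp
qed simp

lemma sum_square_rate_error_le_card:
  assumes spins: "\<And>u. u \<in> U \<Longrightarrow> s u = 1 \<or> s u = -1"
    and rates: "\<And>u. u \<in> U \<Longrightarrow> 0 \<le> r u" "\<And>u. u \<in> U \<Longrightarrow> r u \<le> 1"
  shows "(\<Sum>A\<in>\<C>. 4 * (magnet A (rate_error r s))\<^sup>2 + 4 / card A) \<le> 8 * real (card \<C>)"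
proof (subst mult.commute, rule sum_bounded_above)
  fix A assume A: "A \<in> \<C>"
  have "(magnet A (rate_error r s))\<^sup>2 \<le> 1"
    using community_rate_error_le[OF spins rates A] by (simp add: abs_square_le_1)
  moreover have "4 / real (card A) \<le> 4"
    using finite_community[OF A] community_nonempty[OF A] card_gt_0_iff[of A]
    by (simp add: divide_le_eq)
  ultimately show "4 * (magnet A (rate_error r s))\<^sup>2 + 4 / card A \<le> 8" by linarith
qed

text \<open>Far from the target the crude bound on the rate errors suffices, because there the
  exponential weight is small.\<close>

lemma exp_weighted_rate_error_le_drift_bound:
  assumes spins: "\<And>u. u \<in> U \<Longrightarrow> s u = 1 \<or> s u = -1"
    and rates: "\<And>u. u \<in> U \<Longrightarrow> 0 \<le> r u" "\<And>u. u \<in> U \<Longrightarrow> r u \<le> 1" and k_nonneg: "0 \<le> k"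
    and near: "magnet_dist2 \<C> m s \<le> \<rho>\<^sup>2 \<Longrightarrow> (\<Sum>u\<in>U. rate_error r s u) \<le> \<delta>"
  shows "k * exp (- k * magnet_dist2 \<C> m s)
      * (\<Sum>A\<in>\<C>. 4 * (magnet A (rate_error r s))\<^sup>2 + 4 / card A) \<le> drift_bound \<C> k \<rho> \<delta>"
    (is "k * exp (- k * ?D) * ?R \<le> _")
proof (cases "?D \<le> \<rho>\<^sup>2")
  case True
  have "k * exp (- k * ?D) * ?R \<le> k * 1 * (\<Sum>A\<in>\<C>. 4 * (\<delta> / card A)\<^sup>2 + 4 / card A)"
    using k_nonneg sum_square_rate_error_le_total[OF near[OF True]]
    by (intro mult_mono mult_left_mono sum_nonneg) (auto simp: magnet_dist2_nonneg)
  then show ?thesis using k_nonneg by (simp add: drift_bound_def add_increasing2)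
next
  case False
  then have "k * exp (- k * ?D) * ?R \<le> k * exp (- k * \<rho>\<^sup>2) * (8 * real (card \<C>))"
    using k_nonneg sum_square_rate_error_le_card[OF spins rates]
    by (intro mult_mono mult_left_mono sum_nonneg) (auto simp: mult_left_mono)
  also have "\<dots> \<le> drift_bound \<C> k \<rho> \<delta>" using k_nonneg by (simp add: drift_bound_def sum_nonneg)
  finally show ?thesis .
qed

lemma lyapunov_drift_le:
  assumes spins: "\<And>u. u \<in> U \<Longrightarrow> s u = 1 \<or> s u = -1"
    and rates: "\<And>u. u \<in> U \<Longrightarrow> 0 \<le> r u" "\<And>u. u \<in> U \<Longrightarrow> r u \<le> 1" and k_nonneg: "0 \<le> k"
    and near: "magnet_dist2 \<C> (relaxation \<eta> t) s \<le> \<rho>\<^sup>2 \<Longrightarrow> (\<Sum>u\<in>U. rate_error r s u) \<le> \<delta>"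
  shows "- (k * exp (- k * magnet_dist2 \<C> (relaxation \<eta> t) s)
        * (\<Sum>A\<in>\<C>. 2 * (1 - relaxation \<eta> t) * (magnet A s - relaxation \<eta> t)))
      + (\<Sum>u\<in>U. r u * (lyapunov \<C> k \<eta> t (flip s u) - lyapunov \<C> k \<eta> t s)) \<le> drift_bound \<C> k \<rho> \<delta>"
proof -
  define m where "m = relaxation \<eta> t"
  let ?D = "magnet_dist2 \<C> m" and ?t = "\<Sum>A\<in>\<C>. 2 * (1 - m) * (magnet A s - m)"
  have "(\<Sum>u\<in>U. r u * (lyapunov \<C> k \<eta> t (flip s u) - lyapunov \<C> k \<eta> t s))
      \<le> (\<Sum>u\<in>U. r u * (k * exp (- k * ?D s) * (?D (flip s u) - ?D s)))"
    unfolding lyapunov_def m_def by (intro sum_mono mult_left_mono one_minus_exp_increment_le rates)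
  also have "\<dots> = k * exp (- k * ?D s) * (\<Sum>u\<in>U. r u * (?D (flip s u) - ?D s))"
    by (simp add: sum_distrib_left mult_ac)
  also have "\<dots> \<le> k * exp (- k * ?D s)
      * (?t + (\<Sum>A\<in>\<C>. 4 * (magnet A (rate_error r s))\<^sup>2 + 4 / card A))"
    using spins rates k_nonneg by (intro mult_left_mono magnet_dist2_drift_le) auto
  also have "\<dots> \<le> k * exp (- k * ?D s) * ?t + drift_bound \<C> k \<rho> \<delta>"
    unfolding distrib_left m_def
    by (intro add_left_mono exp_weighted_rate_error_le_drift_bound spins rates k_nonneg near)
  finally show ?thesis by (simp add: m_def)
qed

end

section \<open>Glauber dynamics\<close>

lemma flip_in_configs:
  assumes "\<sigma> \<in> configs N" "u < N"
  shows "flip \<sigma> u \<in> configs N"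
  using assms configs_values[OF assms] unfolding configs_def flip_def
  by (fastforce intro!: PiE_I dest: PiE_mem PiE_arb)

lemma flip_neq:
  assumes "\<sigma> \<in> configs N" "u < N"
  shows "flip \<sigma> u \<noteq> \<sigma>"
proof
  assume "flip \<sigma> u = \<sigma>"
  then have "- \<sigma> u = \<sigma> u" by (metis flip_def fun_upd_same)
  then show False using configs_values[OF assms] by auto
qed

lemma flip_rate_nonneg: "0 \<le> flip_rate \<beta> x"
  unfolding flip_rate_def by (auto intro!: add_nonneg_nonneg)

lemma flip_rate_uminus: "flip_rate \<beta> (- x) = 1 - flip_rate \<beta> x"
proof -
  have "1 / (1 + exp (- y)) = 1 - 1 / (1 + exp y)" for y :: real
    using add_pos_pos[of 1 "exp y"] by (simp add: exp_minus divide_simps)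
  then show ?thesis by (simp add: flip_rate_def)
qed

lemma flip_rate_le_1: "flip_rate \<beta> x \<le> 1"
  using flip_rate_nonneg[of \<beta> "- x"] by (simp add: flip_rate_uminus)

lemma flip_rate_antimono:
  assumes "0 \<le> \<beta>" "x \<le> y"
  shows "flip_rate \<beta> y \<le> flip_rate \<beta> x"
proof -
  have "1 / (1 + exp (b * y)) \<le> 1 / (1 + exp (b * x))" if "0 \<le> b" for b :: real
    using assms(2) that
    by (intro divide_left_mono add_left_mono mult_pos_pos) (auto simp: add_pos_pos mult_left_mono)
  then show ?thesis
    using assms by (auto simp: flip_rate_def real_of_ereal_pos)
qed

lemma generator_apply:
  assumes \<sigma>: "\<sigma> \<in> configs N"
  shows "(\<Sum>\<sigma>'\<in>configs N. generator N E alph \<beta> \<sigma> \<sigma>' * f \<sigma>') =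
         (\<Sum>u<N. flip_rate \<beta> (Delta N E alph \<sigma> u) * (f (flip \<sigma> u) - f \<sigma>))"
proof -
  let ?r = "\<lambda>u. flip_rate \<beta> (Delta N E alph \<sigma> u)"
  have "(\<Sum>\<sigma>'\<in>configs N - {\<sigma>}. generator N E alph \<beta> \<sigma> \<sigma>' * f \<sigma>')
      = (\<Sum>\<sigma>'\<in>configs N - {\<sigma>}. \<Sum>u<N. if flip \<sigma> u = \<sigma>' then ?r u * f \<sigma>' else 0)"
  proof (intro sum.cong refl)
    fix \<sigma>' assume "\<sigma>' \<in> configs N - {\<sigma>}"
    then have "generator N E alph \<beta> \<sigma> \<sigma>' * f \<sigma>' = (\<Sum>u\<in>{u\<in>{..<N}. flip \<sigma> u = \<sigma>'}. ?r u * f \<sigma>')"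
      by (auto simp: generator_def sum_distrib_right intro!: sum.cong)
    also have "\<dots> = (\<Sum>u<N. if flip \<sigma> u = \<sigma>' then ?r u * f \<sigma>' else 0)"
      by (rule sum.inter_filter) simp
    finally show "generator N E alph \<beta> \<sigma> \<sigma>' * f \<sigma>' = \<dots>" .
  qed
  also have "\<dots> = (\<Sum>u<N. \<Sum>\<sigma>'\<in>configs N - {\<sigma>}. if flip \<sigma> u = \<sigma>' then ?r u * f \<sigma>' else 0)"
    by (rule sum.swap)
  also have "\<dots> = (\<Sum>u<N. ?r u * f (flip \<sigma> u))"
    using flip_in_configs[OF \<sigma>] flip_neq[OF \<sigma>] by (intro sum.cong refl) simp
  finally have "(\<Sum>\<sigma>'\<in>configs N. generator N E alph \<beta> \<sigma> \<sigma>' * f \<sigma>')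
      = generator N E alph \<beta> \<sigma> \<sigma> * f \<sigma> + (\<Sum>u<N. ?r u * f (flip \<sigma> u))"
    using \<sigma> by (simp add: sum.remove)
  then show ?thesis
    by (simp add: generator_def right_diff_distrib sum_subtractf sum_distrib_right)
qed

lemma rate_matrix_generator: "rate_matrix (configs N) (generator N E alph \<beta>)"
proof
  show "0 \<le> generator N E alph \<beta> \<sigma> \<sigma>'" if "\<sigma> \<noteq> \<sigma>'" for \<sigma> \<sigma>'
    using that by (auto simp: generator_def intro!: sum_nonneg flip_rate_nonneg)
  show "(\<Sum>\<sigma>'\<in>configs N. generator N E alph \<beta> \<sigma> \<sigma>') = 0" if "\<sigma> \<in> configs N" for \<sigma>
    using generator_apply[OF that, of E alph \<beta> "\<lambda>_. 1"] by simp
qed simp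

definition mean_field :: "nat \<Rightarrow> (nat \<times> nat \<Rightarrow> real) \<Rightarrow> real \<Rightarrow> (nat \<Rightarrow> real) \<Rightarrow> nat \<Rightarrow> real" where
  "mean_field N q alph \<sigma> u = (\<Sum>v\<in>{0..<N} - {u}. (q (min u v, max u v) - alph) * \<sigma> v)"

lemma Delta_eq_noise_plus_mean_field:
  "Delta N E alph \<sigma> u = 2 * \<sigma> u * (noise N q E \<sigma> u + mean_field N q alph \<sigma> u)"
proof -
  have adj_sum: "(\<Sum>v\<in>{v. v < N \<and> adj E u v}. \<sigma> v)
      = (\<Sum>v\<in>{0..<N} - {u}. if adj E u v then \<sigma> v else 0)"
    unfolding sum.inter_filter[symmetric, OF finite_Diff[OF finite_atLeastLessThan]]
    by (intro sum.cong) (auto simp: adj_def)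
  have "(\<Sum>v\<in>{v. v < N \<and> adj E u v}. \<sigma> v) - alph * (\<Sum>v\<in>{0..<N} - {u}. \<sigma> v)
      = noise N q E \<sigma> u + mean_field N q alph \<sigma> u"
    unfolding adj_sum noise_def mean_field_def sum_distrib_left
      sum.distrib[symmetric] sum_subtractf[symmetric]
    by (intro sum.cong refl) (simp add: algebra_simps)
  then show ?thesis by (simp add: Delta_def)
qed

lemma flip_rate_error_le:
  fixes w h l x \<gamma> :: real
  assumes "0 \<le> \<beta>" and \<gamma>_pos: "0 < \<gamma>" and l_sign: "l = 1 \<or> l = -1" and x_sign: "x = 1 \<or> x = -1"
    and strong: "2 * \<gamma> \<le> l * h"
  shows "\<bar>flip_rate \<beta> (2 * x * (w + h)) - (1 - l * x) / 2\<bar> \<le> flip_rate \<beta> (2 * \<gamma>) + \<bar>w\<bar> / \<gamma>"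
proof -
  have "\<bar>flip_rate \<beta> (2 * x * (w + h)) - (1 - l * x) / 2\<bar> = flip_rate \<beta> (2 * (l * w + l * h))"
    using l_sign x_sign flip_rate_uminus[of \<beta> "2 * (w + h)"] flip_rate_uminus[of \<beta> "- 2 * (w + h)"]
      flip_rate_nonneg[of \<beta> "2 * (w + h)"] flip_rate_nonneg[of \<beta> "- 2 * (w + h)"]
    by (auto simp: algebra_simps)
  also have "\<dots> \<le> flip_rate \<beta> (2 * \<gamma>) + \<bar>w\<bar> / \<gamma>"
  proof (cases "\<bar>w\<bar> \<le> \<gamma>")
    case True
    then have "2 * \<gamma> \<le> 2 * (l * w + l * h)" using l_sign strong by auto
    then have "flip_rate \<beta> (2 * (l * w + l * h)) \<le> flip_rate \<beta> (2 * \<gamma>)"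
      by (rule flip_rate_antimono[OF \<open>0 \<le> \<beta>\<close>])
    then show ?thesis using \<gamma>_pos by (simp add: add_increasing2)
  next
    case False
    then have "1 \<le> \<bar>w\<bar> / \<gamma>" using \<gamma>_pos by simp
    then show ?thesis
      using flip_rate_le_1[of \<beta> "2 * (l * w + l * h)"] flip_rate_nonneg[of \<beta> "2 * \<gamma>"] by linarith
  qed
  finally show ?thesis .
qed

section \<open>The two-community block model\<close>

definition label :: "nat \<Rightarrow> nat \<Rightarrow> real" where
  "label V1 u = (if u < V1 then 1 else -1)"

definition aligned :: "nat \<Rightarrow> (nat \<Rightarrow> real) \<Rightarrow> nat \<Rightarrow> real" where
  "aligned V1 \<sigma> u = label V1 u * \<sigma> u"

definition communities :: "nat \<Rightarrow> nat \<Rightarrow> nat set set" where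
  "communities V1 V2 = {{0..<V1}, {V1..<V1 + V2}}"

lemma partition_on_communities:
  assumes "0 < V1" "0 < V2"
  shows "partition_on {..<V1 + V2} (communities V1 V2)"
proof (rule partition_onI)
  show "\<Union> (communities V1 V2) = {..<V1 + V2}" by (auto simp: communities_def)
  show "disjnt A B" if "A \<in> communities V1 V2" "B \<in> communities V1 V2" "A \<noteq> B" for A B
    using that by (auto simp: communities_def disjnt_def)
  show "{} \<notin> communities V1 V2" using assms by (simp add: communities_def)
qed

lemma card_communities:
  assumes "0 < V1"
  shows "card (communities V1 V2) = 2"
proof -
  have "0 \<in> {0..<V1}" "0 \<notin> {V1..<V1 + V2}" using assms by auto
  then have "{0..<V1} \<noteq> {V1..<V1 + V2}" by blast
  then show ?thesis by (simp add: communities_def)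
qed

lemma label_cases: "label V1 u = 1 \<or> label V1 u = -1"
  by (simp add: label_def)

lemma aligned_flip: "aligned V1 (flip \<sigma> u) = flip (aligned V1 \<sigma>) u"
  by (auto simp: fun_eq_iff aligned_def flip_def)

lemma aligned_values:
  assumes "\<sigma> \<in> configs N" "u < N"
  shows "aligned V1 \<sigma> u = 1 \<or> aligned V1 \<sigma> u = -1"
  using configs_values[OF assms] label_cases[of V1 u] by (auto simp: aligned_def)

lemma err_eq_aligned:
  "err V1 V2 \<sigma>
    = max \<bar>magnet {0..<V1} (aligned V1 \<sigma>) - 1\<bar> \<bar>magnet {V1..<V1 + V2} (aligned V1 \<sigma>) - 1\<bar>"
proof -
  have "magnet {0..<V1} (aligned V1 \<sigma>) = magnet {0..<V1} \<sigma>"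
    by (simp add: magnet_def aligned_def label_def)
  moreover have "magnet {V1..<V1 + V2} (aligned V1 \<sigma>) = - magnet {V1..<V1 + V2} \<sigma>"
    by (simp add: magnet_def aligned_def label_def sum_negf)
  ultimately show ?thesis by (simp add: err_def)
qed

lemma err_nonneg: "0 \<le> err V1 V2 \<sigma>"
  by (simp add: err_def)

lemma err_le_2:
  assumes "\<sigma> \<in> configs (V1 + V2)"
  shows "err V1 V2 \<sigma> \<le> 2"
proof -
  have "\<bar>magnet {0..<V1} \<sigma>\<bar> \<le> 1" "\<bar>magnet {V1..<V1 + V2} \<sigma>\<bar> \<le> 1"
    using abs_configs[OF assms] by (auto intro!: abs_magnet_le)
  then show ?thesis unfolding err_def by auto
qed

lemma err_le_sqrt_dist2:
  assumes "m \<le> 1"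
  shows "err V1 V2 \<sigma> \<le> sqrt (magnet_dist2 (communities V1 V2) m (aligned V1 \<sigma>)) + (1 - m)"
proof -
  have "\<bar>magnet A (aligned V1 \<sigma>) - m\<bar> \<le> sqrt (magnet_dist2 (communities V1 V2) m (aligned V1 \<sigma>))"
    if "A \<in> communities V1 V2" for A
    using that by (intro abs_magnet_diff_le_sqrt_dist2) (auto simp: communities_def)
  from this[of "{0..<V1}"] this[of "{V1..<V1 + V2}"] show ?thesis
    using assms by (auto simp: err_eq_aligned communities_def)
qed

lemma err_gt_le_lyapunov:
  assumes k_nonneg: "0 \<le> k" and t_bounds: "\<eta> \<le> 1" "0 \<le> t" "1 - relaxation \<eta> t \<le> \<epsilon> / 2"
    and half: "exp (- k * (\<epsilon> / 2)\<^sup>2) \<le> 1 / 2" and "0 < \<epsilon>"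
  shows "(if \<epsilon> < err V1 V2 \<sigma> then 1 else 0) \<le> 2 * lyapunov (communities V1 V2) k \<eta> t (aligned V1 \<sigma>)"
proof (cases "\<epsilon> < err V1 V2 \<sigma>")
  case True
  let ?D = "magnet_dist2 (communities V1 V2) (relaxation \<eta> t) (aligned V1 \<sigma>)"
  have "\<epsilon> / 2 \<le> sqrt ?D"
    using err_le_sqrt_dist2[of "relaxation \<eta> t" V1 V2 \<sigma>]
      relaxation_bounds(2)[OF t_bounds(1,2)] t_bounds(3) True
    by linarith
  then have "(\<epsilon> / 2)\<^sup>2 \<le> ?D"
    using power_mono[of "\<epsilon> / 2" "sqrt ?D" 2] \<open>0 < \<epsilon>\<close> by (simp add: magnet_dist2_nonneg)
  then have "exp (- k * ?D) \<le> 1 / 2"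
    using mult_left_mono[OF _ k_nonneg] order_trans[OF _ half] by simp
  then show ?thesis using True by (simp add: lyapunov_def)
qed (simp add: lyapunov_nonneg k_nonneg)

lemma edge_prob_min_max:
  "edge_prob V1 pin pout (min u v, max u v) = (if (u < V1) = (v < V1) then pin else pout)"
  by (simp add: edge_prob_def min_def max_def)

lemma aligned_mean_field:
  fixes pin pout alph :: real and \<sigma> :: "nat \<Rightarrow> real"
  assumes AB: "communities V1 V2 = {A, B}" "A \<inter> B = {}" and u: "u \<in> A"
  defines "s \<equiv> aligned V1 \<sigma>"
  shows "label V1 u * mean_field (V1 + V2) (edge_prob V1 pin pout) alph \<sigma> u
    = (pin - alph) * (card A * magnet A s - s u) - (pout - alph) * (card B * magnet B s)"
proof -
  have "A = {0..<V1} \<and> B = {V1..<V1 + V2} \<or> A = {V1..<V1 + V2} \<and> B = {0..<V1}"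
    using AB(1) by (auto simp: communities_def doubleton_eq_iff)
  then have nodes: "{0..<V1 + V2} - {u} = (A - {u}) \<union> B"
    and fin: "finite A" "finite B"
    and same: "\<And>v. v \<in> A \<Longrightarrow> (u < V1) = (v < V1)" and other: "\<And>v. v \<in> B \<Longrightarrow> (u < V1) \<noteq> (v < V1)"
    using u AB(2) by auto
  have "label V1 u * mean_field (V1 + V2) (edge_prob V1 pin pout) alph \<sigma> u
      = (\<Sum>v\<in>A - {u}. label V1 u * ((if (u < V1) = (v < V1) then pin else pout) - alph) * \<sigma> v)
      + (\<Sum>v\<in>B. label V1 u * ((if (u < V1) = (v < V1) then pin else pout) - alph) * \<sigma> v)"
    unfolding mean_field_def nodes edge_prob_min_max sum_distrib_left mult.assoc
    using fin AB(2) by (intro sum.union_disjoint) auto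
  also have "(\<Sum>v\<in>A - {u}. label V1 u * ((if (u < V1) = (v < V1) then pin else pout) - alph) * \<sigma> v)
      = (pin - alph) * (\<Sum>v\<in>A - {u}. s v)"
    unfolding sum_distrib_left using same
    by (intro sum.cong refl) (auto simp: s_def aligned_def label_def)
  also have "(\<Sum>v\<in>A - {u}. s v) = card A * magnet A s - s u"
    using fin u by (simp add: sum_diff1 magnet_def card_gt_0_iff)
  also have "(\<Sum>v\<in>B. label V1 u * ((if (u < V1) = (v < V1) then pin else pout) - alph) * \<sigma> v)
      = - (pout - alph) * (\<Sum>v\<in>B. s v)"
    unfolding sum_distrib_left using other
    by (intro sum.cong refl) (auto simp: s_def aligned_def label_def algebra_simps)
  also have "(\<Sum>v\<in>B. s v) = card B * magnet B s"
    using fin by (cases "B = {}") (simp_all add: magnet_def)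
  finally show ?thesis by (simp only: mult_minus_left diff_conv_add_uminus)
qed

definition field_margin :: "real \<Rightarrow> real \<Rightarrow> real \<Rightarrow> real \<Rightarrow> real \<Rightarrow> real \<Rightarrow> real" where
  "field_margin p q \<eta> \<rho> x y = \<eta> * (p * x - q * y) - \<rho> * (\<bar>p\<bar> * x + \<bar>q\<bar> * y) - \<bar>p\<bar>"

lemma aligned_mean_field_ge_margin:
  fixes pin pout alph m \<rho> :: real
  assumes AB: "communities V1 V2 = {A, B}" "A \<inter> B = {}" and u: "u \<in> A" "u < V1 + V2"
    and \<sigma>: "\<sigma> \<in> configs (V1 + V2)"
    and near: "magnet_dist2 (communities V1 V2) m (aligned V1 \<sigma>) \<le> \<rho>\<^sup>2" and "0 \<le> \<rho>"
  shows "field_margin (pin - alph) (pout - alph) m \<rho> (card A) (card B)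
    \<le> label V1 u * mean_field (V1 + V2) (edge_prob V1 pin pout) alph \<sigma> u"
proof -
  let ?s = "aligned V1 \<sigma>"
  have "\<bar>magnet C ?s - m\<bar> \<le> \<rho>" if "C \<in> communities V1 V2" for C
    using abs_magnet_diff_le_sqrt_dist2[OF _ that, of ?s m] real_sqrt_le_mono[OF near] \<open>0 \<le> \<rho>\<close>
    by (simp add: communities_def)
  then have dev: "\<bar>p * card C * (magnet C ?s - m)\<bar> \<le> \<rho> * (\<bar>p\<bar> * card C)"
    if "C \<in> {A, B}" for p :: real and C
    using that mult_right_mono[of "\<bar>magnet C ?s - m\<bar>" \<rho> "\<bar>p\<bar> * card C"]
    by (simp add: AB(1) abs_mult mult_ac)
  have "\<bar>(pin - alph) * ?s u\<bar> \<le> \<bar>pin - alph\<bar>"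
    using aligned_values[OF \<sigma> u(2), of V1] by auto
  moreover have "label V1 u * mean_field (V1 + V2) (edge_prob V1 pin pout) alph \<sigma> u
      = m * ((pin - alph) * card A - (pout - alph) * card B)
        + (pin - alph) * card A * (magnet A ?s - m) - (pout - alph) * card B * (magnet B ?s - m)
        - (pin - alph) * ?s u"
    unfolding aligned_mean_field[OF AB u(1)] by (simp add: algebra_simps)
  ultimately show ?thesis
    using dev[of A "pin - alph"] dev[of B "pout - alph"]
    unfolding field_margin_def distrib_left by simp
qed

definition strong_field :: "nat \<Rightarrow> nat \<Rightarrow> real \<Rightarrow> real \<Rightarrow> real \<Rightarrow> real \<Rightarrow> real \<Rightarrow> real \<Rightarrow> bool" where
  "strong_field V1 V2 pin pout alph \<eta> \<rho> \<gamma> \<longleftrightarrow>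
     (\<forall>m\<in>{\<eta>..1}. \<forall>\<sigma>\<in>configs (V1 + V2). \<forall>u<V1 + V2.
        magnet_dist2 (communities V1 V2) m (aligned V1 \<sigma>) \<le> \<rho>\<^sup>2 \<longrightarrow>
        2 * \<gamma> \<le> label V1 u * mean_field (V1 + V2) (edge_prob V1 pin pout) alph \<sigma> u)"

lemma field_margin_mono:
  assumes "0 < \<eta>" "\<eta> \<le> m" "0 \<le> \<rho>" "0 \<le> x" "0 \<le> y" "0 \<le> field_margin p q \<eta> \<rho> x y"
  shows "field_margin p q \<eta> \<rho> x y \<le> field_margin p q m \<rho> x y"
proof -
  have "0 \<le> \<rho> * (\<bar>p\<bar> * x + \<bar>q\<bar> * y)"
    using assms by (intro mult_nonneg_nonneg add_nonneg_nonneg) auto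
  then have "0 \<le> \<eta> * (p * x - q * y)" using assms(6) unfolding field_margin_def by linarith
  then have "0 \<le> p * x - q * y" using assms(1) by (simp add: zero_le_mult_iff)
  then show ?thesis using assms(2) unfolding field_margin_def by (simp add: mult_right_mono)
qed

lemma strong_field_of_field_margin:
  assumes \<eta>_pos: "0 < \<eta>" and "0 \<le> \<rho>" "0 \<le> \<gamma>"
    and margin: "2 * \<gamma> \<le> field_margin (pin - alph) (pout - alph) \<eta> \<rho> V1 V2"
      "2 * \<gamma> \<le> field_margin (pin - alph) (pout - alph) \<eta> \<rho> V2 V1"
  shows "strong_field V1 V2 pin pout alph \<eta> \<rho> \<gamma>"
  unfolding strong_field_def
proof (intro ballI allI impI)
  fix m \<sigma> u
  assume m: "m \<in> {\<eta>..1}" and \<sigma>: "\<sigma> \<in> configs (V1 + V2)" and u: "u < V1 + V2"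
    and near: "magnet_dist2 (communities V1 V2) m (aligned V1 \<sigma>) \<le> \<rho>\<^sup>2"
  obtain A B where AB: "communities V1 V2 = {A, B}" "A \<inter> B = {}" "u \<in> A"
    and card_margin: "2 * \<gamma> \<le> field_margin (pin - alph) (pout - alph) \<eta> \<rho> (card A) (card B)"
  proof (cases "u < V1")
    case True
    then show thesis
      using margin by (intro that[of "{0..<V1}" "{V1..<V1 + V2}"]) (auto simp: communities_def)
  next
    case False
    then show thesis
      using u margin by (intro that[of "{V1..<V1 + V2}" "{0..<V1}"]) (auto simp: communities_def)
  qed
  note card_margin
  also have "field_margin (pin - alph) (pout - alph) \<eta> \<rho> (card A) (card B)
      \<le> field_margin (pin - alph) (pout - alph) m \<rho> (card A) (card B)"
    using m \<open>0 \<le> \<gamma>\<close> card_margin by (intro field_margin_mono \<eta>_pos \<open>0 \<le> \<rho>\<close>) auto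
  also have "\<dots> \<le> label V1 u * mean_field (V1 + V2) (edge_prob V1 pin pout) alph \<sigma> u"
    by (rule aligned_mean_field_ge_margin[OF AB u \<sigma> near \<open>0 \<le> \<rho>\<close>])
  finally show "2 * \<gamma> \<le> label V1 u * mean_field (V1 + V2) (edge_prob V1 pin pout) alph \<sigma> u" .
qed

definition spin_weight :: "nat \<Rightarrow> real \<Rightarrow> nat \<Rightarrow> real \<Rightarrow> real" where
  "spin_weight V1 \<eta> u y = \<eta> * (if y = label V1 u then 1 else 0) + (1 - \<eta>) / 2"

lemma init_prob_eq_product_weight: "init_prob N V1 \<eta> = product_weight {0..<N} (spin_weight V1 \<eta>)"
  by (simp add: fun_eq_iff init_prob_def product_weight_def spin_weight_def label_def
      atLeast0LessThan)

lemma independent_coordinates_spin_weight: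
  assumes "0 \<le> \<eta>" "\<eta> \<le> 1"
  shows "independent_coordinates {0..<N} (\<lambda>_. {-1, 1}) (spin_weight V1 \<eta>)"
  using assms by unfold_locales (auto simp: spin_weight_def label_def field_simps)

lemma prob_weights_init_prob:
  assumes "0 \<le> \<eta>" "\<eta> \<le> 1"
  shows "prob_weights (configs N) (init_prob N V1 \<eta>)"
proof -
  interpret independent_coordinates "{0..<N}" "\<lambda>_. {-1, 1}" "spin_weight V1 \<eta>"
    using assms by (rule independent_coordinates_spin_weight)
  show ?thesis
    unfolding init_prob_eq_product_weight configs_def by (rule prob_weights_axioms)
qed

lemma mean_init_prob_magnet_variance:
  assumes \<eta>_bounds: "0 \<le> \<eta>" "\<eta> \<le> 1" and A: "A \<subseteq> {0..<N}" "A \<noteq> {}"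
  shows "mean (configs N) (init_prob N V1 \<eta>) (\<lambda>\<sigma>. (magnet A (aligned V1 \<sigma>) - \<eta>)\<^sup>2)
    = (1 - \<eta>\<^sup>2) / card A"
proof -
  let ?E = "mean (configs N) (init_prob N V1 \<eta>)"
  have "finite A" using A finite_subset by blast
  then have card: "real (card A) > 0" using A by (simp add: card_gt_0_iff)
  have "(magnet A (aligned V1 \<sigma>) - \<eta>)\<^sup>2 = 1 / (card A)\<^sup>2 * (\<Sum>u\<in>A. label V1 u * \<sigma> u - \<eta>)\<^sup>2" for \<sigma>
  proof -
    have "magnet A (aligned V1 \<sigma>) - \<eta> = 1 / card A * (\<Sum>u\<in>A. label V1 u * \<sigma> u - \<eta>)"
      using card by (simp add: magnet_def aligned_def sum_subtractf diff_divide_distrib)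
    then show ?thesis by (simp only: power_mult_distrib) (simp add: power_divide)
  qed
  then have "?E (\<lambda>\<sigma>. (magnet A (aligned V1 \<sigma>) - \<eta>)\<^sup>2)
      = 1 / (card A)\<^sup>2 * ?E (\<lambda>\<sigma>. (\<Sum>u\<in>A. label V1 u * \<sigma> u - \<eta>)\<^sup>2)"
    by (simp only: mean_cmult)
  also have "?E (\<lambda>\<sigma>. (\<Sum>u\<in>A. label V1 u * \<sigma> u - \<eta>)\<^sup>2)
      = (\<Sum>u\<in>A. mean {-1, 1} (spin_weight V1 \<eta> u) (\<lambda>y. (label V1 u * y - \<eta>)\<^sup>2))"
    unfolding init_prob_eq_product_weight configs_def
    using A(1)
    by (intro independent_coordinates.mean_square_sum independent_coordinates_spin_weight \<eta>_bounds)
      (auto simp: mean_def spin_weight_def label_def field_simps)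
  also have "\<dots> = (\<Sum>u\<in>A. 1 - \<eta>\<^sup>2)"
    by (intro sum.cong refl)
      (auto simp: mean_def spin_weight_def label_def power2_eq_square field_simps)
  finally show ?thesis using card by (simp add: power2_eq_square)
qed

lemma edge_prob_bounds:
  assumes "0 \<le> pin" "pin \<le> r" "0 \<le> pout" "pout \<le> r"
  shows "0 \<le> edge_prob V1 pin pout p" "edge_prob V1 pin pout p \<le> r"
  using assms by (auto simp: edge_prob_def)

locale block_model =
  fixes V1 V2 :: nat and pin pout \<eta> :: real
  assumes V1_pos: "0 < V1" and V2_pos: "0 < V2"
    and pin_bounds: "0 \<le> pin" "pin \<le> 1" and pout_bounds: "0 \<le> pout" "pout \<le> 1"
    and \<eta>_bounds: "0 \<le> \<eta>" "\<eta> \<le> 1"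
begin

abbreviation "N \<equiv> V1 + V2"
abbreviation "\<C> \<equiv> communities V1 V2"
abbreviation "q \<equiv> edge_prob V1 pin pout"
abbreviation "graph_mean \<equiv> mean (Pow (pairs N)) (graph_prob N V1 pin pout)"
abbreviation "init_mean \<equiv> mean (configs N) (init_prob N V1 \<eta>)"
abbreviation "glauber_mean E alph \<beta> t \<sigma>0 \<equiv>
  mean (configs N) (ctmc_trans (configs N) (generator N E alph \<beta>) t \<sigma>0)"

sublocale community_partition "{..<N}" \<C>
  using V1_pos V2_pos by unfold_locales (simp_all add: partition_on_communities)

sublocale graph: prob_weights "Pow (pairs N)" "graph_prob N V1 pin pout"
  unfolding graph_prob_eq_random_subset_prob
  using pin_bounds pout_bounds by (intro prob_weights_random_subset edge_prob_bounds) auto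

sublocale init: prob_weights "configs N" "init_prob N V1 \<eta>"
  using \<eta>_bounds by (rule prob_weights_init_prob)

lemma expect_at_eq_iterated_mean:
  "expect_at V1 V2 pin pout alph \<beta> \<eta> t f
    = graph_mean (\<lambda>E. init_mean (\<lambda>\<sigma>0. glauber_mean E alph \<beta> t \<sigma>0 f))"
  by (simp add: expect_at_def mean_def Let_def)

lemma expect_at_as_mean:
  assumes "0 \<le> t"
  obtains w where "prob_weights (configs N) w"
    and "\<And>f. expect_at V1 V2 pin pout alph \<beta> \<eta> t f = mean (configs N) w f"
proof
  let ?P = "\<lambda>E. ctmc_trans (configs N) (generator N E alph \<beta>) t"
  show "prob_weights (configs N) (\<lambda>\<sigma>. graph_mean (\<lambda>E. init_mean (\<lambda>\<sigma>0. ?P E \<sigma>0 \<sigma>)))"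
    by (intro graph.prob_weights_mixture init.prob_weights_mixture
        rate_matrix.prob_weights_ctmc_trans rate_matrix_generator assms)
  show "expect_at V1 V2 pin pout alph \<beta> \<eta> t f
    = mean (configs N) (\<lambda>\<sigma>. graph_mean (\<lambda>E. init_mean (\<lambda>\<sigma>0. ?P E \<sigma>0 \<sigma>))) f" for f
  proof -
    have "init_mean (\<lambda>\<sigma>0. glauber_mean E alph \<beta> t \<sigma>0 f)
        = mean (configs N) (\<lambda>\<sigma>. init_mean (\<lambda>\<sigma>0. ?P E \<sigma>0 \<sigma>)) f" for E
      by (rule mean_mean)
    then show ?thesis
      unfolding expect_at_eq_iterated_mean by (simp only:) (rule mean_mean)
  qed
qed

lemma init_mean_magnet_dist2_le:
  "init_mean (\<lambda>\<sigma>. magnet_dist2 \<C> \<eta> (aligned V1 \<sigma>)) \<le> (\<Sum>A\<in>\<C>. 1 / card A)"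
  unfolding magnet_dist2_def mean_sum
proof (rule sum_mono)
  fix A assume A: "A \<in> \<C>"
  then have "A \<subseteq> {0..<N}" by (auto simp: communities_def)
  then show "init_mean (\<lambda>\<sigma>. (magnet A (aligned V1 \<sigma>) - \<eta>)\<^sup>2) \<le> 1 / card A"
    using \<eta>_bounds community_nonempty[OF A]
    by (simp add: mean_init_prob_magnet_variance divide_right_mono)
qed

lemma total_rate_error_le:
  assumes field: "strong_field V1 V2 pin pout alph \<eta> \<rho> \<gamma>" and noise: "low_noise N q s E"
    and \<gamma>_pos: "0 < \<gamma>" and \<beta>_nonneg: "0 \<le> \<beta>" and m: "\<eta> \<le> m" "m \<le> 1" and \<sigma>: "\<sigma> \<in> configs N"
    and near: "magnet_dist2 \<C> m (aligned V1 \<sigma>) \<le> \<rho>\<^sup>2"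
  shows "(\<Sum>u<N. rate_error (\<lambda>u. flip_rate \<beta> (Delta N E alph \<sigma> u)) (aligned V1 \<sigma>) u)
    \<le> N * flip_rate \<beta> (2 * \<gamma>) + s / \<gamma>"
proof -
  let ?w = "noise N q E \<sigma>"
  have "rate_error (\<lambda>u. flip_rate \<beta> (Delta N E alph \<sigma> u)) (aligned V1 \<sigma>) u
      \<le> flip_rate \<beta> (2 * \<gamma>) + \<bar>?w u\<bar> / \<gamma>" if u: "u < N" for u
  proof -
    have "2 * \<gamma> \<le> label V1 u * mean_field N q alph \<sigma> u"
      using field m \<sigma> u near by (auto simp: strong_field_def)
    then show ?thesis
      unfolding rate_error_def aligned_def Delta_eq_noise_plus_mean_field[where q = q]
      by (intro flip_rate_error_le \<beta>_nonneg \<gamma>_pos label_cases configs_values[OF \<sigma> u])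
  qed
  then have "(\<Sum>u<N. rate_error (\<lambda>u. flip_rate \<beta> (Delta N E alph \<sigma> u)) (aligned V1 \<sigma>) u)
      \<le> (\<Sum>u<N. flip_rate \<beta> (2 * \<gamma>) + \<bar>?w u\<bar> / \<gamma>)"
    by (intro sum_mono) simp
  also have "\<dots> = N * flip_rate \<beta> (2 * \<gamma>) + (\<Sum>u<N. \<bar>?w u\<bar>) / \<gamma>"
    by (simp add: sum.distrib sum_divide_distrib)
  also have "\<dots> \<le> N * flip_rate \<beta> (2 * \<gamma>) + s / \<gamma>"
    using noise \<sigma> \<gamma>_pos by (intro add_left_mono divide_right_mono) (auto simp: low_noise_def)
  finally show ?thesis .
qed

lemma glauber_mean_lyapunov_le:
  assumes field: "strong_field V1 V2 pin pout alph \<eta> \<rho> \<gamma>" and noise: "low_noise N q s E"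
    and \<gamma>_pos: "0 < \<gamma>" and \<beta>_nonneg: "0 \<le> \<beta>" and k_nonneg: "0 \<le> k" and T_nonneg: "0 \<le> T"
    and \<sigma>0: "\<sigma>0 \<in> configs N"
  shows "glauber_mean E alph \<beta> T \<sigma>0 (\<lambda>\<sigma>. lyapunov \<C> k \<eta> T (aligned V1 \<sigma>))
    \<le> k * magnet_dist2 \<C> \<eta> (aligned V1 \<sigma>0)
      + drift_bound \<C> k \<rho> (N * flip_rate \<beta> (2 * \<gamma>) + s / \<gamma>) * T"
proof -
  let ?L = "lyapunov \<C> k \<eta>"
  have "glauber_mean E alph \<beta> T \<sigma>0 (\<lambda>\<sigma>. ?L T (aligned V1 \<sigma>)) \<le> ?L 0 (aligned V1 \<sigma>0)
      + drift_bound \<C> k \<rho> (N * flip_rate \<beta> (2 * \<gamma>) + s / \<gamma>) * T"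
  proof (rule rate_matrix.mean_ctmc_trans_le_of_drift_le[OF rate_matrix_generator \<sigma>0 T_nonneg
        lyapunov_has_derivative])
    fix t \<sigma> assume t: "(0::real) \<le> t" and \<sigma>: "\<sigma> \<in> configs N"
    show "- (k * exp (- k * magnet_dist2 \<C> (relaxation \<eta> t) (aligned V1 \<sigma>))
          * (\<Sum>A\<in>\<C>. 2 * (1 - relaxation \<eta> t) * (magnet A (aligned V1 \<sigma>) - relaxation \<eta> t)))
        + (\<Sum>\<sigma>'\<in>configs N. generator N E alph \<beta> \<sigma> \<sigma>' * ?L t (aligned V1 \<sigma>'))
        \<le> drift_bound \<C> k \<rho> (N * flip_rate \<beta> (2 * \<gamma>) + s / \<gamma>)"
      unfolding generator_apply[OF \<sigma>] aligned_flip
      by (intro lyapunov_drift_le flip_rate_nonneg flip_rate_le_1 k_nonneg aligned_values[OF \<sigma>]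
          total_rate_error_le[OF field noise \<gamma>_pos \<beta>_nonneg
            relaxation_bounds[OF \<eta>_bounds(2) t] \<sigma>]) auto
  qed
  also have "?L 0 (aligned V1 \<sigma>0) \<le> k * magnet_dist2 \<C> \<eta> (aligned V1 \<sigma>0)"
    by (rule lyapunov_0_le)
  finally show ?thesis by simp
qed

lemma init_mean_glauber_mean_lyapunov_le:
  assumes field: "strong_field V1 V2 pin pout alph \<eta> \<rho> \<gamma>" and noise: "low_noise N q s E"
    and \<gamma>_pos: "0 < \<gamma>" and \<beta>_nonneg: "0 \<le> \<beta>" and k_nonneg: "0 \<le> k" and T_nonneg: "0 \<le> T"
  shows "init_mean (\<lambda>\<sigma>0. glauber_mean E alph \<beta> T \<sigma>0 (\<lambda>\<sigma>. lyapunov \<C> k \<eta> T (aligned V1 \<sigma>)))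
    \<le> k * (\<Sum>A\<in>\<C>. 1 / card A) + drift_bound \<C> k \<rho> (N * flip_rate \<beta> (2 * \<gamma>) + s / \<gamma>) * T"
    (is "?L \<le> _ + ?\<kappa> * T")
proof -
  have "?L \<le> init_mean (\<lambda>\<sigma>0. k * magnet_dist2 \<C> \<eta> (aligned V1 \<sigma>0) + ?\<kappa> * T)"
    by (intro init.mean_mono glauber_mean_lyapunov_le field noise \<gamma>_pos \<beta>_nonneg k_nonneg T_nonneg)
  also have "\<dots> = k * init_mean (\<lambda>\<sigma>0. magnet_dist2 \<C> \<eta> (aligned V1 \<sigma>0)) + ?\<kappa> * T"
    by (simp only: mean_add mean_cmult init.mean_const)
  also have "\<dots> \<le> k * (\<Sum>A\<in>\<C>. 1 / card A) + ?\<kappa> * T"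
    by (intro add_right_mono mult_left_mono init_mean_magnet_dist2_le k_nonneg)
  finally show ?thesis .
qed

lemma expect_at_lyapunov_le:
  assumes field: "strong_field V1 V2 pin pout alph \<eta> \<rho> \<gamma>"
    and \<gamma>_pos: "0 < \<gamma>" and \<beta>_nonneg: "0 \<le> \<beta>" and k_nonneg: "0 \<le> k" and T_nonneg: "0 \<le> T"
    and r_bounds: "pin \<le> r" "pout \<le> r" "r \<le> 1" and \<theta>_bounds: "0 \<le> \<theta>" "\<theta> \<le> 1/2"
  shows "expect_at V1 V2 pin pout alph \<beta> \<eta> T (\<lambda>\<sigma>. lyapunov \<C> k \<eta> T (aligned V1 \<sigma>))
    \<le> 4 ^ N * exp (4 * \<theta>\<^sup>2 * r * real N ^ 2 - \<theta> * s) + k * (\<Sum>A\<in>\<C>. 1 / card A)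
      + drift_bound \<C> k \<rho> (N * flip_rate \<beta> (2 * \<gamma>) + s / \<gamma>) * T"
proof -
  let ?L = "\<lambda>E. init_mean (\<lambda>\<sigma>0. glauber_mean E alph \<beta> T \<sigma>0 (\<lambda>\<sigma>. lyapunov \<C> k \<eta> T (aligned V1 \<sigma>)))"
  define b where "b = k * (\<Sum>A\<in>\<C>. 1 / card A)
      + drift_bound \<C> k \<rho> (N * flip_rate \<beta> (2 * \<gamma>) + s / \<gamma>) * T"
  have "?L E \<le> 1" for E
    by (intro init.mean_le_const prob_weights.mean_le_const[OF rate_matrix.prob_weights_ctmc_trans]
        rate_matrix_generator T_nonneg lyapunov_le_1)
  moreover have "?L E \<le> b" if "low_noise N q s E" for E
    unfolding b_def
    by (intro init_mean_glauber_mean_lyapunov_le field that \<gamma>_pos \<beta>_nonneg k_nonneg T_nonneg)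
  moreover have "0 \<le> b"
    using k_nonneg T_nonneg by (simp add: b_def drift_bound_def sum_nonneg)
  ultimately have "?L E \<le> (if low_noise N q s E then 0 else 1) + b" for E
    by (simp add: add_increasing2)
  then have "graph_mean ?L \<le> graph_mean (\<lambda>E. (if low_noise N q s E then 0 else 1) + b)"
    by (intro graph.mean_mono)
  also have "\<dots> = graph_mean (\<lambda>E. if low_noise N q s E then 0 else 1) + b"
    by (simp only: mean_add graph.mean_const)
  also have "graph_mean (\<lambda>E. if low_noise N q s E then 0 else 1)
      \<le> 4 ^ N * exp (4 * \<theta>\<^sup>2 * r * real N ^ 2 - \<theta> * s)"
    unfolding graph_prob_eq_random_subset_prob
    using pin_bounds pout_bounds by (intro prob_not_low_noise_le edge_prob_bounds r_bounds \<theta>_bounds)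
  finally show ?thesis by (simp add: expect_at_eq_iterated_mean b_def)
qed

end

section \<open>Asymptotics\<close>

lemma pow_4_mult_exp_le:
  fixes K a C l :: real
  assumes n_pos: "0 < n" and N_le: "real N \<le> K * n" and l_pos: "0 < l" and a_nonneg: "0 \<le> a"
    and C_ge: "2 * K + 4 * a * K\<^sup>2 + 1 \<le> C"
  shows "4 ^ N * exp (4 * (1 / sqrt l)\<^sup>2 * (a * l / n) * real N ^ 2 - 1 / sqrt l * (C * n * sqrt l))
    \<le> exp (- n)"
proof -
  have "(4::real) = (1 + 1)\<^sup>2" by simp
  also have "\<dots> \<le> (exp 1)\<^sup>2" using exp_ge_add_one_self[of 1] by (intro power_mono) auto
  also have "\<dots> = exp 2" using exp_double[of "1::real"] by simp
  finally have "(4::real) ^ N \<le> exp 2 ^ N" by (intro power_mono) auto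
  also have "\<dots> = exp (2 * N)" by (simp add: exp_of_nat_mult[symmetric] mult.commute)
  finally have pow: "(4::real) ^ N \<le> exp (2 * N)" .
  have "4 * a / n * real N ^ 2 \<le> 4 * a / n * (K * n)\<^sup>2"
    using n_pos N_le a_nonneg by (intro mult_left_mono power_mono) auto
  also have "\<dots> = 4 * a * K\<^sup>2 * n" using n_pos by (simp add: power2_eq_square)
  finally have exponent: "2 * N + (4 * a / n * real N ^ 2 - C * n) \<le> - n"
    using n_pos N_le mult_right_mono[OF C_ge, of n] by (simp add: algebra_simps)
  have "4 * (1 / sqrt l)\<^sup>2 * (a * l / n) * real N ^ 2 - 1 / sqrt l * (C * n * sqrt l)
      = 4 * a / n * real N ^ 2 - C * n"
    using l_pos by (simp add: power_divide)
  then have "4 ^ N * exp (4 * (1 / sqrt l)\<^sup>2 * (a * l / n) * real N ^ 2 - 1 / sqrt l * (C * n * sqrt l))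
      \<le> exp (2 * N) * exp (4 * a / n * real N ^ 2 - C * n)"
    using pow by simp
  also have "\<dots> \<le> exp (- n)"
    using exponent by (simp flip: exp_add)
  finally show ?thesis .
qed

lemma sqrt_mult_divide_self:
  fixes l x :: real
  assumes "0 < l"
  shows "sqrt l * (x / l) = x / sqrt l"
proof -
  have "sqrt l / l = inverse (sqrt l)" using assms by (simp add: sqrt_divide_self_eq)
  moreover have "sqrt l * (x / l) = x * (sqrt l / l)" by simp
  ultimately show ?thesis by (simp only: divide_inverse)
qed

lemma drift_bound_sqrt_le:
  fixes K M \<delta> \<rho> l :: real
  assumes l_ge_1: "1 \<le> l" and "0 \<le> \<delta>" and \<delta>_le: "\<And>A. A \<in> \<C> \<Longrightarrow> \<delta> / card A \<le> K / sqrt l"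
    and size: "\<And>A. A \<in> \<C> \<Longrightarrow> 1 / card A \<le> M / l"
  shows "drift_bound \<C> (sqrt l) \<rho> \<delta>
    \<le> card \<C> * (4 * K\<^sup>2 + 4 * M) / sqrt l + 8 * real (card \<C>) * sqrt l * exp (- sqrt l * \<rho>\<^sup>2)"
proof -
  have "(\<Sum>A\<in>\<C>. 4 * (\<delta> / card A)\<^sup>2 + 4 / card A) \<le> card \<C> * (4 * (K / sqrt l)\<^sup>2 + 4 * (M / l))"
  proof (rule sum_bounded_above)
    fix A assume A: "A \<in> \<C>"
    have "(\<delta> / card A)\<^sup>2 \<le> (K / sqrt l)\<^sup>2"
      using \<delta>_le[OF A] \<open>0 \<le> \<delta>\<close> by (intro power_mono) auto
    then show "4 * (\<delta> / card A)\<^sup>2 + 4 / card A \<le> 4 * (K / sqrt l)\<^sup>2 + 4 * (M / l)"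
      using size[OF A] by simp
  qed
  also have "\<dots> = card \<C> * (4 * K\<^sup>2 + 4 * M) / l"
    using l_ge_1 by (simp add: power_divide add_divide_distrib distrib_left)
  finally have "sqrt l * (\<Sum>A\<in>\<C>. 4 * (\<delta> / card A)\<^sup>2 + 4 / card A)
      \<le> sqrt l * (card \<C> * (4 * K\<^sup>2 + 4 * M) / l)"
    by (intro mult_left_mono) (use l_ge_1 in auto)
  also have "\<dots> = card \<C> * (4 * K\<^sup>2 + 4 * M) / sqrt l"
    using l_ge_1 by (intro sqrt_mult_divide_self) simp
  finally show ?thesis by (simp add: drift_bound_def)
qed

lemma inverse_community_size_le:
  fixes w a l n V :: real
  assumes "0 < w" "0 < a" "0 < l" "a * l \<le> n" "w * n \<le> V"
  shows "1 / V \<le> 1 / (w * a) / l"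
proof -
  have "w * (a * l) \<le> w * n" using assms by (intro mult_left_mono) auto
  then have "w * a * l \<le> V" using assms(5) by (simp add: mult.assoc)
  moreover have "0 < w * a * l" using assms by simp
  ultimately have "1 / V \<le> 1 / (w * a * l)" by (intro frac_le) auto
  then show ?thesis by simp
qed

lemma rate_error_over_size_le:
  fixes w l n N V K C \<gamma> \<phi> :: real
  assumes "0 < w" "0 < n" "1 \<le> l" "0 < \<gamma>" "0 \<le> C"
    and "0 \<le> N" "N \<le> K * n" "w * n \<le> V" "0 \<le> \<phi>" "\<phi> \<le> 1 / l"
  shows "(N * \<phi> + C * n * sqrt l / (\<gamma> * l)) / V \<le> (K + C / \<gamma>) / w / sqrt l"
proof -
  have "sqrt l \<le> l" using assms(3) by (intro real_le_lsqrt) (auto simp: power2_eq_square)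
  then have "1 / l \<le> 1 / sqrt l" using assms(3) by (intro divide_left_mono) auto
  then have "N * \<phi> \<le> K * n * (1 / sqrt l)"
    using assms by (intro mult_mono) auto
  moreover have "C * n * sqrt l / (\<gamma> * l) = C / \<gamma> * n * (1 / sqrt l)"
    using assms(3) sqrt_mult_divide_self[of l "C / \<gamma> * n"] by (simp add: mult_ac)
  moreover have "K * n * (1 / sqrt l) + C / \<gamma> * n * (1 / sqrt l) = (K + C / \<gamma>) * n / sqrt l"
    by (simp add: distrib_right add_divide_distrib)
  ultimately have "N * \<phi> + C * n * sqrt l / (\<gamma> * l) \<le> (K + C / \<gamma>) * n / sqrt l" by linarith
  moreover have "0 \<le> K * n" using assms(6,7) by linarith
  then have "0 \<le> K" using assms(2) by (simp add: zero_le_mult_iff)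
  ultimately have "(N * \<phi> + C * n * sqrt l / (\<gamma> * l)) / V \<le> ((K + C / \<gamma>) * n / sqrt l) / (w * n)"
    using assms by (intro frac_le) (auto intro!: add_nonneg_nonneg divide_nonneg_nonneg)
  then show ?thesis using assms(2) by (simp add: mult.commute)
qed

lemma (in block_model) expect_at_lyapunov_scaled_le:
  fixes a b l w K \<gamma> :: real and n :: nat
  assumes scaling: "pin = a * l / n" "pout = b * l / n" "b \<le> a" "0 < a" "a * l \<le> n" "4 \<le> l"
    and n_pos: "0 < n"
    and field: "strong_field V1 V2 pin pout alph \<eta> \<rho> (\<gamma> * l)" and \<gamma>_pos: "0 < \<gamma>"
    and \<beta>_bounds: "0 \<le> \<beta>" "flip_rate \<beta> (2 * (\<gamma> * l)) \<le> 1 / l" and T_nonneg: "0 \<le> T"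
    and node_count: "real N \<le> K * n" "0 \<le> K" and sizes: "0 < w" "\<And>A. A \<in> \<C> \<Longrightarrow> w * n \<le> card A"
  defines "C \<equiv> 2 * K + 4 * a * K\<^sup>2 + 1" and "M \<equiv> 1 / (w * a)"
  shows "expect_at V1 V2 pin pout alph \<beta> \<eta> T (\<lambda>\<sigma>. lyapunov \<C> (sqrt l) \<eta> T (aligned V1 \<sigma>))
    \<le> exp (- real n) + 2 * M / sqrt l
      + (2 * (4 * ((K + C / \<gamma>) / w)\<^sup>2 + 4 * M) / sqrt l + 16 * sqrt l * exp (- sqrt l * \<rho>\<^sup>2)) * T"
proof -
  let ?\<delta> = "N * flip_rate \<beta> (2 * (\<gamma> * l)) + C * n * sqrt l / (\<gamma> * l)"
  have l_bounds: "0 < l" "1 \<le> l" "2 \<le> sqrt l" using \<open>4 \<le> l\<close> real_sqrt_le_mono[of 4 l] by auto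
  have C_pos: "0 < C" using node_count(2) \<open>0 < a\<close> by (simp add: C_def add_nonneg_pos)
  have card: "card \<C> = 2" using V1_pos by (rule card_communities)
  have size: "1 / card A \<le> M / l" if "A \<in> \<C>" for A
    unfolding M_def using scaling l_bounds sizes(1) sizes(2)[OF that]
    by (intro inverse_community_size_le) auto
  have "expect_at V1 V2 pin pout alph \<beta> \<eta> T (\<lambda>\<sigma>. lyapunov \<C> (sqrt l) \<eta> T (aligned V1 \<sigma>))
      \<le> 4 ^ N * exp (4 * (1 / sqrt l)\<^sup>2 * (a * l / n) * real N ^ 2 - 1 / sqrt l * (C * n * sqrt l))
        + sqrt l * (\<Sum>A\<in>\<C>. 1 / card A) + drift_bound \<C> (sqrt l) \<rho> ?\<delta> * T"
    using l_bounds scaling n_pos \<beta>_bounds T_nonneg \<gamma>_pos field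
    by (intro expect_at_lyapunov_le) (auto simp: divide_right_mono)
  also have "\<dots> \<le> exp (- real n) + 2 * M / sqrt l
      + (card \<C> * (4 * ((K + C / \<gamma>) / w)\<^sup>2 + 4 * M) / sqrt l
        + 8 * real (card \<C>) * sqrt l * exp (- sqrt l * \<rho>\<^sup>2)) * T"
  proof (intro add_mono mult_right_mono T_nonneg)
    show "4 ^ N * exp (4 * (1 / sqrt l)\<^sup>2 * (a * l / n) * real N ^ 2
          - 1 / sqrt l * (C * n * sqrt l))
        \<le> exp (- real n)"
      using n_pos node_count l_bounds \<open>0 < a\<close> by (intro pow_4_mult_exp_le) (auto simp: C_def)
    have "sqrt l * (\<Sum>A\<in>\<C>. 1 / card A) \<le> sqrt l * (card \<C> * (M / l))"
      using l_bounds size by (intro mult_left_mono sum_bounded_above) auto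
    also have "\<dots> = 2 * M / sqrt l"
      using l_bounds sqrt_mult_divide_self[of l "2 * M"] by (simp add: card)
    finally show "sqrt l * (\<Sum>A\<in>\<C>. 1 / card A) \<le> 2 * M / sqrt l" .
    show "drift_bound \<C> (sqrt l) \<rho> ?\<delta> \<le> card \<C> * (4 * ((K + C / \<gamma>) / w)\<^sup>2 + 4 * M) / sqrt l
        + 8 * real (card \<C>) * sqrt l * exp (- sqrt l * \<rho>\<^sup>2)"
      using l_bounds C_pos n_pos node_count sizes \<gamma>_pos \<beta>_bounds(2) flip_rate_nonneg
      by (intro drift_bound_sqrt_le size rate_error_over_size_le add_nonneg_nonneg) auto
  qed
  finally show ?thesis by (simp add: card)
qed

lemma field_margin_scale:
  assumes "0 \<le> l"
  shows "field_margin (l * p) (l * q) \<eta> \<rho> x y = l * field_margin p q \<eta> \<rho> x y"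
  using assms by (simp add: field_margin_def abs_mult algebra_simps)

lemma tendsto_field_margin:
  assumes "(\<lambda>n. X n / real n) \<longlonglongrightarrow> x" "(\<lambda>n. Y n / real n) \<longlonglongrightarrow> y"
  shows "(\<lambda>n. field_margin (p / n) (q / n) \<eta> \<rho> (X n) (Y n))
    \<longlonglongrightarrow> \<eta> * (p * x - q * y) - \<rho> * (\<bar>p\<bar> * x + \<bar>q\<bar> * y)"
proof -
  have "(\<lambda>n. \<eta> * (p * (X n / n) - q * (Y n / n))
        - \<rho> * (\<bar>p\<bar> * (X n / n) + \<bar>q\<bar> * (Y n / n)) - \<bar>p\<bar> / n)
      \<longlonglongrightarrow> \<eta> * (p * x - q * y) - \<rho> * (\<bar>p\<bar> * x + \<bar>q\<bar> * y) - 0"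
    by (intro tendsto_intros assms lim_const_over_n)
  then show ?thesis by (simp add: field_margin_def)
qed

lemma lyapunov_bound_tendsto_0:
  fixes x y z c r :: real
  assumes "0 < r"
  shows "((\<lambda>l. x / sqrt l + (y / sqrt l + z * sqrt l * exp (- sqrt l * r)) * (c * ln l)) \<longlongrightarrow> 0)
    at_top"
proof -
  have "((\<lambda>l::real. 1 / sqrt l) \<longlongrightarrow> 0) at_top" by real_asymp
  moreover have "((\<lambda>l::real. ln l / sqrt l) \<longlongrightarrow> 0) at_top" by real_asymp
  moreover have "((\<lambda>l. sqrt l * exp (- sqrt l * r) * ln l) \<longlongrightarrow> 0) at_top" using assms by real_asymp
  ultimately have "((\<lambda>l. x * (1 / sqrt l) + y * c * (ln l / sqrt l)
      + z * c * (sqrt l * exp (- sqrt l * r) * ln l))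
      \<longlongrightarrow> x * 0 + y * c * 0 + z * c * 0) at_top"
    by (intro tendsto_intros)
  then show ?thesis by (simp add: algebra_simps)
qed

locale assortative_block_models =
  fixes a b \<alpha> \<eta> c v1 v2 :: real
    and lam :: "nat \<Rightarrow> real" and \<beta> :: "nat \<Rightarrow> ereal"
    and V1 V2 :: "nat \<Rightarrow> nat"
  assumes ab: "a > b" "b > 0"
    and eta: "0 < \<eta>" "\<eta> \<le> 1"
    and lam_prob: "\<forall>\<^sub>F n in sequentially. a * lam n \<le> real n"
    and lam_lim: "filterlim lam at_top sequentially"
    and V1_lim: "(\<lambda>n. real (V1 n) / real n) \<longlonglongrightarrow> v1"
    and V2_lim: "(\<lambda>n. real (V2 n) / real n) \<longlonglongrightarrow> v2"
    and v_pos: "v1 > 0" "v2 > 0"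
    and field_pos: "0 < (a - \<alpha>) * v1 - (b - \<alpha>) * v2" "0 < (a - \<alpha>) * v2 - (b - \<alpha>) * v1"
    and beta_pos: "\<And>n. \<beta> n > 0"
    and beta_lim: "(\<lambda>n. \<beta> n * ereal (lam n / ln (lam n))) \<longlonglongrightarrow> \<infinity>"
    and c_pos: "0 < c"
begin

abbreviation comm :: "nat \<Rightarrow> nat set set" where
  "comm n \<equiv> communities (V1 n) (V2 n)"

abbreviation terminal_mean :: "nat \<Rightarrow> ((nat \<Rightarrow> real) \<Rightarrow> real) \<Rightarrow> real" where
  "terminal_mean n \<equiv>
     expect_at (V1 n) (V2 n) (a * lam n / n) (b * lam n / n) (\<alpha> * lam n / n)
       (\<beta> n) \<eta> (c * ln (lam n))"

lemma eventually_lam: "eventually P at_top \<Longrightarrow> \<forall>\<^sub>F n in sequentially. P (lam n)"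
  using lam_lim by (rule eventually_compose_filterlim[rotated])

lemma eventually_community_size:
  obtains w :: real where "0 < w" "\<forall>\<^sub>F n in sequentially. \<forall>A\<in>comm n. w * n \<le> card A"
proof
  show "0 < min v1 v2 / 2" using v_pos by simp
  have "\<forall>\<^sub>F n in sequentially. min v1 v2 / 2 < V1 n / n"
    by (rule order_tendstoD[OF V1_lim]) (use v_pos in linarith)
  moreover have "\<forall>\<^sub>F n in sequentially. min v1 v2 / 2 < V2 n / n"
    by (rule order_tendstoD[OF V2_lim]) (use v_pos in linarith)
  ultimately show "\<forall>\<^sub>F n in sequentially. \<forall>A\<in>comm n. min v1 v2 / 2 * n \<le> card A"
    using eventually_gt_at_top[of 0]
    by eventually_elim (auto simp: communities_def field_simps)
qed

lemma eventually_node_count_le: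
  obtains K :: real where "0 \<le> K" "\<forall>\<^sub>F n in sequentially. real (V1 n + V2 n) \<le> K * n"
proof
  show "0 \<le> v1 + v2 + 1" using v_pos by simp
  have "(\<lambda>n. V1 n / n + V2 n / n) \<longlonglongrightarrow> v1 + v2" by (intro tendsto_intros V1_lim V2_lim)
  then have "\<forall>\<^sub>F n in sequentially. V1 n / n + V2 n / n < v1 + v2 + 1"
    by (rule order_tendstoD) simp
  then show "\<forall>\<^sub>F n in sequentially. real (V1 n + V2 n) \<le> (v1 + v2 + 1) * n"
    using eventually_gt_at_top[of 0] by eventually_elim (simp add: field_simps)
qed

lemma eventually_block_model:
  "\<forall>\<^sub>F n in sequentially. block_model (V1 n) (V2 n) (a * lam n / n) (b * lam n / n) \<eta>"
proof -
  obtain w :: real where "0 < w" "\<forall>\<^sub>F n in sequentially. \<forall>A\<in>comm n. w * n \<le> card A"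
    by (rule eventually_community_size)
  from this(2) lam_prob eventually_lam[OF eventually_ge_at_top[of 0]] eventually_gt_at_top[of 0]
  show ?thesis
  proof eventually_elim
    case (elim n)
    have "0 < w * n" using \<open>0 < w\<close> elim(4) by simp
    then have "0 < V1 n" "0 < V2 n" using elim(1) by (auto simp: communities_def intro!: gr0I)
    moreover have "b * lam n \<le> a * lam n" using ab elim(3) by (intro mult_right_mono) auto
    then have "b * lam n \<le> n" using elim(2) by linarith
    ultimately show ?case using elim ab eta by unfold_locales auto
  qed
qed

lemma eventually_strong_field:
  obtains \<rho> \<gamma> where "0 < \<rho>" "0 < \<gamma>" "\<forall>\<^sub>F n in sequentially.
    strong_field (V1 n) (V2 n) (a * lam n / n) (b * lam n / n) (\<alpha> * lam n / n) \<eta> \<rho> (\<gamma> * lam n)"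
proof -
  define margin where
    "margin \<rho> x y = \<eta> * ((a - \<alpha>) * x - (b - \<alpha>) * y) - \<rho> * (\<bar>a - \<alpha>\<bar> * x + \<bar>b - \<alpha>\<bar> * y)" for \<rho> x y
  have "\<forall>\<^sub>F \<rho> in at_right 0. 0 < margin \<rho> x y" if "0 < (a - \<alpha>) * x - (b - \<alpha>) * y" for x y
  proof (rule order_tendstoD(1))
    show "((\<lambda>\<rho>. margin \<rho> x y) \<longlongrightarrow> \<eta> * ((a - \<alpha>) * x - (b - \<alpha>) * y)) (at_right 0)"
      unfolding margin_def by (auto intro!: tendsto_eq_intros)
  qed (use eta that in simp)
  from this[OF field_pos(1)] this[OF field_pos(2)] eventually_at_right_less[of 0]
  have "\<forall>\<^sub>F \<rho> in at_right 0. 0 < \<rho> \<and> 0 < margin \<rho> v1 v2 \<and> 0 < margin \<rho> v2 v1"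
    by eventually_elim simp
  then obtain \<rho> where \<rho>_bounds: "0 < \<rho>" "0 < margin \<rho> v1 v2" "0 < margin \<rho> v2 v1"
    using eventually_happens'[OF trivial_limit_at_right_real] by blast
  define \<gamma> where "\<gamma> = min (margin \<rho> v1 v2) (margin \<rho> v2 v1) / 4"
  have \<gamma>_bounds: "0 < \<gamma>" "2 * \<gamma> < margin \<rho> v1 v2" "2 * \<gamma> < margin \<rho> v2 v1"
    using \<rho>_bounds by (auto simp: \<gamma>_def)
  note order_tendstoD(1)[OF tendsto_field_margin[OF V1_lim V2_lim]
      \<gamma>_bounds(2)[unfolded margin_def]]
    and order_tendstoD(1)[OF tendsto_field_margin[OF V2_lim V1_lim]
      \<gamma>_bounds(3)[unfolded margin_def]]
  with eventually_lam[OF eventually_ge_at_top[of 0]]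
  have "\<forall>\<^sub>F n in sequentially.
      strong_field (V1 n) (V2 n) (a * lam n / n) (b * lam n / n) (\<alpha> * lam n / n) \<eta> \<rho> (\<gamma> * lam n)"
  proof eventually_elim
    case (elim n)
    have "p * lam n / n - \<alpha> * lam n / n = lam n * ((p - \<alpha>) / n)" for p
      by (simp add: algebra_simps diff_divide_distrib)
    then have scale:
      "field_margin (a * lam n / n - \<alpha> * lam n / n) (b * lam n / n - \<alpha> * lam n / n) \<eta> \<rho> x y
        = lam n * field_margin ((a - \<alpha>) / n) ((b - \<alpha>) / n) \<eta> \<rho> x y" for x y
      by (simp only: field_margin_scale[OF elim(1)])
    have "2 * (\<gamma> * lam n) \<le> lam n * x" if "2 * \<gamma> < x" for x
      using mult_left_mono[OF less_imp_le[OF that] elim(1)] by (simp add: mult_ac)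
    then show ?case
      using \<rho>_bounds(1) \<gamma>_bounds(1) eta(1) elim
      by (intro strong_field_of_field_margin) (simp_all add: scale)
  qed
  then show thesis using that \<rho>_bounds(1) \<gamma>_bounds(1) by blast
qed

lemma eventually_flip_rate_le:
  assumes "0 < \<gamma>"
  shows "\<forall>\<^sub>F n in sequentially. flip_rate (\<beta> n) (\<gamma> * lam n) \<le> 1 / lam n"
proof -
  have "\<forall>\<^sub>F n in sequentially. ereal (1 / \<gamma>) < \<beta> n * ereal (lam n / ln (lam n))"
    using beta_lim by (simp add: tendsto_PInfty)
  then show ?thesis
    using eventually_lam[OF eventually_gt_at_top[of 1]]
  proof eventually_elim
    case (elim n)
    show ?case
    proof (cases "\<beta> n")
      case (real x)
      have "ln (lam n) < x * (\<gamma> * lam n)" using elim real assms by (simp add: field_simps)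
      then have "lam n \<le> exp (x * (\<gamma> * lam n))"
        using elim exp_less_cancel_iff[of "ln (lam n)" "x * (\<gamma> * lam n)"] by simp
      then show ?thesis using elim real by (simp add: flip_rate_def frac_le)
    next
      case PInf
      then show ?thesis using elim assms by (simp add: flip_rate_def mult_less_0_iff)
    qed (use beta_pos[of n] in auto)
  qed
qed

lemma eventually_terminal_mean_as_mean:
  "\<forall>\<^sub>F n in sequentially. \<exists>w. prob_weights (configs (V1 n + V2 n)) w
      \<and> (\<forall>f. terminal_mean n f = mean (configs (V1 n + V2 n)) w f)"
  using eventually_block_model eventually_lam[OF eventually_ge_at_top[of 1]]
proof eventually_elim
  case (elim n)
  have "0 \<le> c * ln (lam n)" using c_pos elim(2) by simp
  then show ?case by (rule block_model.expect_at_as_mean[OF elim(1)]) blast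
qed

lemma eventually_terminal_mean_nonneg:
  assumes "\<forall>\<^sub>F n in sequentially. \<forall>\<sigma>. 0 \<le> f n \<sigma>"
  shows "\<forall>\<^sub>F n in sequentially. 0 \<le> terminal_mean n (f n)"
  using eventually_terminal_mean_as_mean assms
  by eventually_elim (auto intro!: prob_weights.mean_nonneg)

lemma terminal_mean_lyapunov_tendsto_0:
  "(\<lambda>n. terminal_mean n
      (\<lambda>\<sigma>. lyapunov (comm n) (sqrt (lam n)) \<eta> (c * ln (lam n)) (aligned (V1 n) \<sigma>))) \<longlonglongrightarrow> 0"
    (is "?L \<longlonglongrightarrow> 0")
proof -
  obtain w :: real where sizes: "0 < w" "\<forall>\<^sub>F n in sequentially. \<forall>A\<in>comm n. w * n \<le> card A"
    by (rule eventually_community_size)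
  obtain \<rho> \<gamma> where \<rho>_pos: "0 < \<rho>" and \<gamma>_pos: "0 < \<gamma>" and field: "\<forall>\<^sub>F n in sequentially.
      strong_field (V1 n) (V2 n) (a * lam n / n) (b * lam n / n) (\<alpha> * lam n / n) \<eta> \<rho> (\<gamma> * lam n)"
    by (rule eventually_strong_field)
  obtain K :: real where node_count: "0 \<le> K" "\<forall>\<^sub>F n in sequentially. real (V1 n + V2 n) \<le> K * n"
    by (rule eventually_node_count_le)
  have "0 < 2 * \<gamma>" using \<gamma>_pos by simp
  define x where "x = 2 * (1 / (w * a))"
  define y where "y = 2 * (4 * ((K + (2 * K + 4 * a * K\<^sup>2 + 1) / \<gamma>) / w)\<^sup>2 + 4 * (1 / (w * a)))"
  define B where
    "B l = x / sqrt l + (y / sqrt l + 16 * sqrt l * exp (- sqrt l * \<rho>\<^sup>2)) * (c * ln l)" for l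
  have upper: "\<forall>\<^sub>F n in sequentially. ?L n \<le> exp (- real n) + B (lam n)"
    using eventually_block_model field sizes(2) node_count(2)
      eventually_flip_rate_le[OF \<open>0 < 2 * \<gamma>\<close>] lam_prob
      eventually_lam[OF eventually_ge_at_top[of 4]] eventually_gt_at_top[of 0]
  proof eventually_elim
    case (elim n)
    interpret block_model "V1 n" "V2 n" "a * lam n / n" "b * lam n / n" \<eta> by (rule elim(1))
    have "?L n \<le> exp (- real n) + x / sqrt (lam n)
      + (y / sqrt (lam n) + 16 * sqrt (lam n) * exp (- sqrt (lam n) * \<rho>\<^sup>2)) * (c * ln (lam n))"
      unfolding x_def y_def
      using elim ab \<gamma>_pos sizes(1) node_count(1) beta_pos[of n] c_pos
      by (intro expect_at_lyapunov_scaled_le) (auto simp: field_simps)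
    then show ?case by (simp add: B_def)
  qed
  have lower: "\<forall>\<^sub>F n in sequentially. 0 \<le> ?L n"
    using eventually_lam[OF eventually_ge_at_top[of 0]]
    by (intro eventually_terminal_mean_nonneg) (auto elim!: eventually_mono intro: lyapunov_nonneg)
  have "(\<lambda>n. exp (- real n) + B (lam n)) \<longlonglongrightarrow> 0 + 0"
  proof (intro tendsto_add)
    show "(\<lambda>n. exp (- real n)) \<longlonglongrightarrow> 0" by real_asymp
    show "(\<lambda>n. B (lam n)) \<longlonglongrightarrow> 0"
      unfolding B_def using \<rho>_pos
      by (intro filterlim_compose[OF lyapunov_bound_tendsto_0 lam_lim]) simp
  qed
  then show ?thesis
    using tendsto_sandwich[OF lower upper tendsto_const] by simp
qed

lemma err_tendsto_0_in_probability:
  assumes "0 < \<epsilon>"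
  shows "(\<lambda>n. terminal_mean n (\<lambda>\<sigma>. if \<epsilon> < err (V1 n) (V2 n) \<sigma> then 1 else 0)) \<longlonglongrightarrow> 0"
    (is "?P \<longlonglongrightarrow> 0")
proof -
  let ?L = "\<lambda>n \<sigma>. lyapunov (comm n) (sqrt (lam n)) \<eta> (c * ln (lam n)) (aligned (V1 n) \<sigma>)"
  have "((\<lambda>l. (1 - \<eta>) * exp (- (c * ln l))) \<longlongrightarrow> (1 - \<eta>) * 0) at_top"
    by (intro tendsto_mult_left) (use c_pos in real_asymp)
  then have "\<forall>\<^sub>F l in at_top. (1 - \<eta>) * exp (- (c * ln l)) < \<epsilon> / 2"
    by (rule order_tendstoD) (use assms in simp)
  then have relaxed: "\<forall>\<^sub>F n in sequentially. 1 - relaxation \<eta> (c * ln (lam n)) < \<epsilon> / 2"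
    by (auto simp: relaxation_def dest: eventually_lam)
  have "((\<lambda>l. exp (- sqrt l * (\<epsilon> / 2)\<^sup>2)) \<longlongrightarrow> 0) at_top"
    using zero_less_power[of "\<epsilon> / 2" 2] assms by real_asymp
  then have "\<forall>\<^sub>F l in at_top. exp (- sqrt l * (\<epsilon> / 2)\<^sup>2) < 1 / 2"
    by (rule order_tendstoD) simp
  then have half: "\<forall>\<^sub>F n in sequentially. exp (- sqrt (lam n) * (\<epsilon> / 2)\<^sup>2) < 1 / 2"
    by (rule eventually_lam)
  have lower: "\<forall>\<^sub>F n in sequentially. 0 \<le> ?P n"
    by (rule eventually_terminal_mean_nonneg) simp
  have upper: "\<forall>\<^sub>F n in sequentially. ?P n \<le> 2 * terminal_mean n (?L n)"
    using eventually_terminal_mean_as_mean relaxed half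
      eventually_lam[OF eventually_ge_at_top[of 1]]
  proof eventually_elim
    case (elim n)
    then obtain w where w: "prob_weights (configs (V1 n + V2 n)) w"
        "\<And>f. terminal_mean n f = mean (configs (V1 n + V2 n)) w f" by blast
    have "?P n \<le> mean (configs (V1 n + V2 n)) w (\<lambda>\<sigma>. 2 * ?L n \<sigma>)"
      unfolding w(2) using elim eta c_pos assms
      by (intro prob_weights.mean_mono[OF w(1)] err_gt_le_lyapunov) auto
    then show ?case by (simp only: mean_cmult w(2))
  qed
  show ?thesis
    by (rule tendsto_sandwich[OF lower upper tendsto_const
          tendsto_mult_right_zero[OF terminal_mean_lyapunov_tendsto_0]])
qed

lemma err_tendsto_0_in_mean: "(\<lambda>n. terminal_mean n (err (V1 n) (V2 n))) \<longlonglongrightarrow> 0"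
proof -
  obtain w where w: "\<forall>\<^sub>F n in sequentially. prob_weights (configs (V1 n + V2 n)) (w n)
      \<and> (\<forall>f. terminal_mean n f = mean (configs (V1 n + V2 n)) (w n) f)"
    using eventually_terminal_mean_as_mean unfolding eventually_ex by blast
  have eq: "\<forall>\<^sub>F n in sequentially.
      terminal_mean n (f n) = mean (configs (V1 n + V2 n)) (w n) (f n)" for f
    using w by eventually_elim simp
  have "(\<lambda>n. mean (configs (V1 n + V2 n)) (w n) (err (V1 n) (V2 n))) \<longlonglongrightarrow> 0"
  proof (rule tendsto_mean_of_tendsto_in_prob)
    show "\<forall>\<^sub>F n in sequentially. prob_weights (configs (V1 n + V2 n)) (w n)"
      using w by eventually_elim simp
    show "(\<lambda>n. mean (configs (V1 n + V2 n)) (w n)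
        (\<lambda>\<sigma>. if \<epsilon> < err (V1 n) (V2 n) \<sigma> then 1 else 0)) \<longlonglongrightarrow> 0"
      if "0 < \<epsilon>" for \<epsilon>
      by (rule Lim_transform_eventually[OF err_tendsto_0_in_probability[OF that] eq])
  qed (auto intro: err_nonneg err_le_2)
  then show ?thesis
    by (rule Lim_transform_eventually) (use eq in \<open>simp add: eq_commute\<close>)
qed

end

lemma assortative_field_pos:
  fixes a b \<alpha> v1 v2 :: real
  assumes "b < a" "0 < v2" "v2 \<le> v1"
    and \<alpha>: "v1 > v2 \<longrightarrow> (b * v1 - a * v2) / (v1 - v2) < \<alpha> \<and> \<alpha> < (a * v1 - b * v2) / (v1 - v2)"
  shows "0 < (a - \<alpha>) * v1 - (b - \<alpha>) * v2" "0 < (a - \<alpha>) * v2 - (b - \<alpha>) * v1"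
proof -
  have "b * v1 - a * v2 < \<alpha> * (v1 - v2) \<and> \<alpha> * (v1 - v2) < a * v1 - b * v2"
  proof (cases "v1 > v2")
    case True
    with \<alpha> show ?thesis by (simp add: pos_divide_less_eq pos_less_divide_eq)
  next
    case False
    then have "v1 = v2" using \<open>v2 \<le> v1\<close> by simp
    moreover have "b * v2 < a * v2" using assms(1,2) by simp
    ultimately show ?thesis by simp
  qed
  then show "0 < (a - \<alpha>) * v1 - (b - \<alpha>) * v2" "0 < (a - \<alpha>) * v2 - (b - \<alpha>) * v1"
    by (simp_all add: algebra_simps)
qed

theorem theorem3p2:
  fixes a b \<alpha> \<eta> c v1 v2 :: real
    and lam :: "nat \<Rightarrow> real" and \<beta> :: "nat \<Rightarrow> ereal"
    and V1 V2 :: "nat \<Rightarrow> nat"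
  assumes ab: "a > b" "b > 0"
    and eta: "0 < \<eta>" "\<eta> \<le> 1"
    and lam_prob: "\<forall>\<^sub>F n in sequentially. a * lam n \<le> real n"
    and lam_lim: "filterlim lam at_top sequentially"
    and V1_lim: "(\<lambda>n. real (V1 n) / real n) \<longlonglongrightarrow> v1"
    and V2_lim: "(\<lambda>n. real (V2 n) / real n) \<longlonglongrightarrow> v2"
    and v_pos: "v1 > 0" "v2 > 0"
    and v_ord: "v1 \<ge> v2"
    and alpha: "v1 > v2 \<longrightarrow> (b * v1 - a * v2) / (v1 - v2) < \<alpha> \<and> \<alpha> < (a * v1 - b * v2) / (v1 - v2)"
    and beta_pos: "\<And>n. \<beta> n > 0"
    and beta_lim: "(\<lambda>n. \<beta> n * ereal (lam n / ln (lam n))) \<longlonglongrightarrow> \<infinity>"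
    and c: "0 < c" "c < 1/4"
  shows "(\<forall>\<epsilon>>0. (\<lambda>n. expect_at (V1 n) (V2 n) (a * lam n / n) (b * lam n / n) (\<alpha> * lam n / n)
                        (\<beta> n) \<eta> (c * ln (lam n))
                        (\<lambda>\<sigma>. if err (V1 n) (V2 n) \<sigma> > \<epsilon> then 1 else 0)) \<longlonglongrightarrow> 0)
       \<and> (\<lambda>n. expect_at (V1 n) (V2 n) (a * lam n / n) (b * lam n / n) (\<alpha> * lam n / n)
                        (\<beta> n) \<eta> (c * ln (lam n)) (err (V1 n) (V2 n))) \<longlonglongrightarrow> 0"
proof -
  interpret assortative_block_models a b \<alpha> \<eta> c v1 v2 lam \<beta> V1 V2
    using assms assortative_field_pos[OF ab(1) v_pos(2) v_ord alpha] by unfold_locales auto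
  show ?thesis
    using err_tendsto_0_in_probability err_tendsto_0_in_mean by blast
qed

end
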